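(* Let $G$ be a finite group, $H$ an abelian subgroup of $G$, and let $\Omega\in\mathbb{C}(H)\otimes\mathbb{C}(H)\subset\mathbb{C}(G)\otimes\mathbb{C}(G)$ be a (pseudo)-co-involutive 2-(pseudo)-cocycle of $\mathbb{C}(G)$ lifted from $H$, with $u=m(\mathrm{id}\otimes\kappa)\Omega$ the corresponding unitary in $\mathbb{C}(G)$, such that $(\mathbb{C}(G),\Delta_\Omega,\varepsilon,\kappa_\Omega)$ is a Kac algebra. Let $\alpha$ be an automorphism of $G$, extended to $\mathbb{C}(G)$ by $\alpha(\lambda(g))=\lambda(\alpha(g))$, and let $\gamma$ be the automorphism of the $C^*$-algebra $\mathbb{C}(G)$ defined by $\gamma(x)=u\alpha(x)u^*$ for $x\in\mathbb{C}(G)$. Suppose that: 1. $\alpha(u)=u^*$; 2. the element $(\alpha^{-1}\otimes\alpha^{-1})(\Omega^u)\,\Omega^*$ belongs to the commutant of $\Delta(\mathbb{C}(G))$; 3. $\varepsilon(u)=1$. Then $\gamma$ is an automorphism of the coalgebra $(\mathbb{C}(G),\Delta_\Omega,\varepsilon)$, i.e. $(\gamma\otimes\gamma)\circ\Delta_\Omega=\Delta_\Omega\circ\gamma$ and $\varepsilon\circ\gamma=\varepsilon$. If $\kappa(u)=u$, then $\gamma$ is an automorphism of the Kac algebra $(\mathbb{C}(G),\Delta_\Omega,\varepsilon,\kappa_\Omega)$. The condition $\kappa(u)=u$ always holds when $\Omega$ is a counital 2-cocycle; if $\Omega$ is only a 2-pseudo-cocycle, then one should verify that $\gamma$ commutes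 with $\kappa_\Omega$.
   Context: $\mathbb{C}(G)$ is the $C^*$-algebra generated by the left regular representation $\lambda$ of $G$, a cocommutative Kac algebra with $\Delta(\lambda(g))=\lambda(g)\otimes\lambda(g)$, $\varepsilon(\lambda(g))=1$, $\kappa(\lambda(g))=\lambda(g^{-1})$; $\mathbb{C}(H)\subset\mathbb{C}(G)$ is the subalgebra generated by $\lambda(h)$, $h\in H$. A (finite dimensional) Kac algebra is a finite dimensional $C^*$-algebra with a coassociative unital $*$-homomorphism as coproduct, a counit, and an antipode which is an involutive $*$-anti-automorphism. An automorphism of a Kac algebra is a $*$-algebra automorphism which intertwines the coproduct and preserves the counit and commutes with the antipode. Twisting. With $A=\mathbb{C}(G)$, a 2-cocycle is a unitary $\Omega\in A\otimes A$ with $(\Omega\otimes1)(\Delta\otimes \mathrm{id})(\Omega)=(1\otimes\Omega)(\mathrm{id}\otimes\Delta)(\Omega)$; it is counital if $(\varepsilon\otimes \mathrm{id})\Omega=(\mathrm{id}\otimes\varepsilon)\Omega=1$. A 2-pseudo-cocycle is a unitary $\Omega\in A\otimes A$ such that $(\mathrm{id}\otimes\Delta)(\Omega^* )(1\otimes\Omega^* )(\Omega\otimes1)(\Delta\otimes \mathrm{id})(\Omega)$ lies in the commutant of $(\Delta\otimes \mathrm{id})\Delta(A)$. Put $\Delta_\Omega(x)=\Omega\Delta(x)\Omega^*$ (coassociative iff $\Omega$ is a 2-pseudo-cocycle). For a unitary $u\in A$ put $\Omega^u=(u^*\otimes u^* )\Omega\Delta(u)$, and let $\Sigma$ be the flip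 of $A\otimes A$. $\Omega$ is pseudo-co-involutive (resp. co-involutive), with respect to $u$, if $\Omega^u(\Sigma(\kappa\otimes\kappa)(\Omega^* ))^*\in\Delta(A)'$ (resp. $\Sigma(\kappa\otimes\kappa)(\Omega^* )=\Omega^u$), where $\Delta(A)'$ is the commutant of $\Delta(A)$ in $A\otimes A$. In that case $\kappa_\Omega(x)=u\kappa(x)u^*$. Lifting from $H$. Let $\hat H$ be the dual group of $H$ and let $P_x$, $x\in\hat H$, be the mutually orthogonal projections in $\mathbb{C}(H)$ determined by $\lambda(h)=\sum_{x\in\hat H}\langle x,h\rangle P_x$. The lifted element is $\Omega=\sum_{x,y\in\hat H}\omega(x,y)\,P_x\otimes P_y$ for a function $\omega:\hat H\times\hat H\to\mathbb{T}$, and $u=m(\mathrm{id}\otimes\kappa)\Omega=\sum_{x\in\hat H}\omega(x,x^{-1})P_x$, where $m$ is the multiplication of $A$.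
   Formalization: The formal statement additionally assumes that (α⁻¹⊗α⁻¹)(Ω^u) and Ω* commute (automatic when α(H)=H); without it condition 2 has its factors in the wrong order and the coalgebra claim fails in general. *)

theory Defs
  imports Complex_Main "HOL-Algebra.Group"
begin

section \<open>Finite dimensional \<open>C\<^sup>*\<close>-algebras of operators\<close>

text \<open>
  An operator on \<open>\<ell>\<^sup>2(I)\<close>, for a finite set \<open>I\<close>, is given by its matrix, a function that is
  zero outside \<open>I \<times> I\<close>. A finite dimensional \<open>C\<^sup>*\<close>-algebra is a unital \<open>*\<close>-algebra of such
  operators; it is norm closed because the dimension is finite, and every finite
  dimensional \<open>C\<^sup>*\<close>-algebra is of this form up to isomorphism.
\<close>

type_synonym 'i oper = "'i \<Rightarrow> 'i \<Rightarrow> complex"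

definition opers :: "'i set \<Rightarrow> 'i oper set" where
  "opers I = {x. \<forall>i j. i \<notin> I \<or> j \<notin> I \<longrightarrow> x i j = 0}"

definition op_add :: "'i oper \<Rightarrow> 'i oper \<Rightarrow> 'i oper" where
  "op_add x y = (\<lambda>i j. x i j + y i j)"

definition op_scale :: "complex \<Rightarrow> 'i oper \<Rightarrow> 'i oper" where
  "op_scale c x = (\<lambda>i j. c * x i j)"

definition op_mult :: "'i oper \<Rightarrow> 'i set \<Rightarrow> 'i oper \<Rightarrow> 'i oper"
    ("(_ \<star>\<^bsub>_\<^esub> _)" [70, 0, 71] 70) where
  "x \<star>\<^bsub>I\<^esub> y = (\<lambda>i j. \<Sum>k\<in>I. x i k * y k j)"

definition op_one :: "'i set \<Rightarrow> 'i oper" where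
  "op_one I = (\<lambda>i j. if i \<in> I \<and> i = j then 1 else 0)"

definition adj :: "'i oper \<Rightarrow> 'i oper" where
  "adj x = (\<lambda>i j. cnj (x j i))"

definition fd_cstar_algebra :: "'i set \<Rightarrow> 'i oper set \<Rightarrow> bool" where
  "fd_cstar_algebra I A \<longleftrightarrow>
     finite I \<and> A \<subseteq> opers I \<and> op_one I \<in> A \<and>
     (\<forall>x\<in>A. \<forall>y\<in>A. op_add x y \<in> A \<and> x \<star>\<^bsub>I\<^esub> y \<in> A) \<and>
     (\<forall>c. \<forall>x\<in>A. op_scale c x \<in> A) \<and>
     (\<forall>x\<in>A. adj x \<in> A)"

definition cstar_generated :: "'i set \<Rightarrow> 'i oper set \<Rightarrow> 'i oper set" where
  "cstar_generated I S = \<Inter> {A. fd_cstar_algebra I A \<and> S \<subseteq> A}"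

definition unitary_in :: "'i set \<Rightarrow> 'i oper set \<Rightarrow> 'i oper \<Rightarrow> bool" where
  "unitary_in I A u \<longleftrightarrow> u \<in> A \<and> u \<star>\<^bsub>I\<^esub> adj u = op_one I \<and> adj u \<star>\<^bsub>I\<^esub> u = op_one I"

definition commutant :: "'i set \<Rightarrow> 'i oper set \<Rightarrow> 'i oper set \<Rightarrow> 'i oper set" where
  "commutant I A S = {x \<in> A. \<forall>y\<in>S. x \<star>\<^bsub>I\<^esub> y = y \<star>\<^bsub>I\<^esub> x}"

definition star_hom ::
  "'i set \<Rightarrow> 'i oper set \<Rightarrow> 'j set \<Rightarrow> 'j oper set \<Rightarrow> ('i oper \<Rightarrow> 'j oper) \<Rightarrow> bool" where
  "star_hom I A J B f \<longleftrightarrow>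
     (\<forall>x\<in>A. f x \<in> B) \<and>
     (\<forall>x\<in>A. \<forall>y\<in>A. f (op_add x y) = op_add (f x) (f y)) \<and>
     (\<forall>c. \<forall>x\<in>A. f (op_scale c x) = op_scale c (f x)) \<and>
     (\<forall>x\<in>A. \<forall>y\<in>A. f (x \<star>\<^bsub>I\<^esub> y) = f x \<star>\<^bsub>J\<^esub> f y) \<and>
     (\<forall>x\<in>A. f (adj x) = adj (f x)) \<and>
     f (op_one I) = op_one J"

definition star_automorphism :: "'i set \<Rightarrow> 'i oper set \<Rightarrow> ('i oper \<Rightarrow> 'i oper) \<Rightarrow> bool" where
  "star_automorphism I A f \<longleftrightarrow> star_hom I A I A f \<and> bij_betw f A A"


section \<open>Tensor products\<close>

definition tensor :: "'i oper \<Rightarrow> 'j oper \<Rightarrow> ('i \<times> 'j) oper" where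
  "tensor x y = (\<lambda>p q. x (fst p) (fst q) * y (snd p) (snd q))"

text \<open>Scalars can be absorbed into the first factor, so finite sums suffice.\<close>

definition tensor_alg :: "'i oper set \<Rightarrow> 'j oper set \<Rightarrow> ('i \<times> 'j) oper set" where
  "tensor_alg A B =
     {\<lambda>p q. \<Sum>(a, b)\<leftarrow>ps. tensor a b p q | ps. set ps \<subseteq> A \<times> B}"

text \<open>
  The linear map on \<open>A \<otimes> B\<close> induced by a bilinear map \<open>T\<close> on \<open>A \<times> B\<close>, that is,
  \<open>\<Sum>\<^sub>k a\<^sub>k \<otimes> b\<^sub>k \<mapsto> \<Sum>\<^sub>k T a\<^sub>k b\<^sub>k\<close>. The result does not depend on the decomposition when \<open>A\<close>, \<open>B\<close>
  are linear subspaces and \<open>T\<close> is bilinear on them.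
\<close>

definition tensor_lift ::
  "'i oper set \<Rightarrow> 'j oper set \<Rightarrow> ('i oper \<Rightarrow> 'j oper \<Rightarrow> 'k oper) \<Rightarrow> ('i \<times> 'j) oper \<Rightarrow> 'k oper" where
  "tensor_lift A B T X =
     (THE Y. \<exists>ps. set ps \<subseteq> A \<times> B \<and>
        X = (\<lambda>p q. \<Sum>(a, b)\<leftarrow>ps. tensor a b p q) \<and>
        Y = (\<lambda>p q. \<Sum>(a, b)\<leftarrow>ps. T a b p q))"

abbreviation tensor_map ::
  "'i oper set \<Rightarrow> 'j oper set \<Rightarrow> ('i oper \<Rightarrow> 'k oper) \<Rightarrow> ('j oper \<Rightarrow> 'l oper)
     \<Rightarrow> ('i \<times> 'j) oper \<Rightarrow> ('k \<times> 'l) oper" where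
  "tensor_map A B f g \<equiv> tensor_lift A B (\<lambda>a b. tensor (f a) (g b))"

text \<open>Slices by a linear functional, with \<open>\<complex> \<otimes> A\<close> and \<open>A \<otimes> \<complex>\<close> identified with \<open>A\<close>.\<close>

abbreviation slice_left :: "'i oper set \<Rightarrow> ('i oper \<Rightarrow> complex) \<Rightarrow> ('i \<times> 'i) oper \<Rightarrow> 'i oper" where
  "slice_left A e \<equiv> tensor_lift A A (\<lambda>a b. op_scale (e a) b)"

abbreviation slice_right :: "'i oper set \<Rightarrow> ('i oper \<Rightarrow> complex) \<Rightarrow> ('i \<times> 'i) oper \<Rightarrow> 'i oper" where
  "slice_right A e \<equiv> tensor_lift A A (\<lambda>a b. op_scale (e b) a)"

abbreviation mult_map :: "'i set \<Rightarrow> 'i oper set \<Rightarrow> ('i \<times> 'i) oper \<Rightarrow> 'i oper" where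
  "mult_map I A \<equiv> tensor_lift A A (\<lambda>a b. a \<star>\<^bsub>I\<^esub> b)"

definition flip :: "('i \<times> 'j) oper \<Rightarrow> ('j \<times> 'i) oper" where
  "flip X = (\<lambda>p q. X (snd p, fst p) (snd q, fst q))"

text \<open>Threefold tensor products are indexed by \<open>I \<times> (I \<times> I)\<close>;
  \<open>(x \<otimes> y) \<otimes> z\<close> is moved there by the reindexing below.\<close>

definition assoc :: "(('i \<times> 'j) \<times> 'k) oper \<Rightarrow> ('i \<times> 'j \<times> 'k) oper" where
  "assoc X = (\<lambda>(i, j, k) (i', j', k'). X ((i, j), k) ((i', j'), k'))"


section \<open>Kac algebras\<close>

definition coproduct_on :: "'i set \<Rightarrow> 'i oper set \<Rightarrow> ('i oper \<Rightarrow> ('i \<times> 'i) oper) \<Rightarrow> bool" where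
  "coproduct_on I A D \<longleftrightarrow>
     star_hom I A (I \<times> I) (tensor_alg A A) D \<and>
     (\<forall>x\<in>A. assoc (tensor_map A A D id (D x)) = tensor_map A A id D (D x))"

definition counit_on ::
  "'i set \<Rightarrow> 'i oper set \<Rightarrow> ('i oper \<Rightarrow> ('i \<times> 'i) oper) \<Rightarrow> ('i oper \<Rightarrow> complex) \<Rightarrow> bool" where
  "counit_on I A D e \<longleftrightarrow>
     (\<forall>x\<in>A. \<forall>y\<in>A. e (op_add x y) = e x + e y) \<and>
     (\<forall>c. \<forall>x\<in>A. e (op_scale c x) = c * e x) \<and>
     (\<forall>x\<in>A. \<forall>y\<in>A. e (x \<star>\<^bsub>I\<^esub> y) = e x * e y) \<and>
     (\<forall>x\<in>A. e (adj x) = cnj (e x)) \<and>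
     e (op_one I) = 1 \<and>
     (\<forall>x\<in>A. slice_left A e (D x) = x \<and> slice_right A e (D x) = x)"

definition antipode_on ::
  "'i set \<Rightarrow> 'i oper set \<Rightarrow> ('i oper \<Rightarrow> ('i \<times> 'i) oper) \<Rightarrow> ('i oper \<Rightarrow> complex)
     \<Rightarrow> ('i oper \<Rightarrow> 'i oper) \<Rightarrow> bool" where
  "antipode_on I A D e k \<longleftrightarrow>
     (\<forall>x\<in>A. k x \<in> A \<and> k (k x) = x) \<and>
     (\<forall>x\<in>A. \<forall>y\<in>A. k (op_add x y) = op_add (k x) (k y)) \<and>
     (\<forall>c. \<forall>x\<in>A. k (op_scale c x) = op_scale c (k x)) \<and>
     (\<forall>x\<in>A. \<forall>y\<in>A. k (x \<star>\<^bsub>I\<^esub> y) = k y \<star>\<^bsub>I\<^esub> k x) \<and>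
     (\<forall>x\<in>A. k (adj x) = adj (k x)) \<and>
     (\<forall>x\<in>A. mult_map I A (tensor_map A A k id (D x)) = op_scale (e x) (op_one I) \<and>
            mult_map I A (tensor_map A A id k (D x)) = op_scale (e x) (op_one I))"

definition kac_algebra ::
  "'i set \<Rightarrow> 'i oper set \<Rightarrow> ('i oper \<Rightarrow> ('i \<times> 'i) oper) \<Rightarrow> ('i oper \<Rightarrow> complex)
     \<Rightarrow> ('i oper \<Rightarrow> 'i oper) \<Rightarrow> bool" where
  "kac_algebra I A D e k \<longleftrightarrow>
     fd_cstar_algebra I A \<and> coproduct_on I A D \<and> counit_on I A D e \<and> antipode_on I A D e k"

definition coalgebra_automorphism ::
  "'i oper set \<Rightarrow> ('i oper \<Rightarrow> ('i \<times> 'i) oper) \<Rightarrow> ('i oper \<Rightarrow> complex)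
     \<Rightarrow> ('i oper \<Rightarrow> 'i oper) \<Rightarrow> bool" where
  "coalgebra_automorphism A D e f \<longleftrightarrow>
     bij_betw f A A \<and>
     (\<forall>x\<in>A. \<forall>y\<in>A. f (op_add x y) = op_add (f x) (f y)) \<and>
     (\<forall>c. \<forall>x\<in>A. f (op_scale c x) = op_scale c (f x)) \<and>
     (\<forall>x\<in>A. tensor_map A A f f (D x) = D (f x)) \<and>
     (\<forall>x\<in>A. e (f x) = e x)"

definition kac_automorphism ::
  "'i set \<Rightarrow> 'i oper set \<Rightarrow> ('i oper \<Rightarrow> ('i \<times> 'i) oper) \<Rightarrow> ('i oper \<Rightarrow> complex)
     \<Rightarrow> ('i oper \<Rightarrow> 'i oper) \<Rightarrow> ('i oper \<Rightarrow> 'i oper) \<Rightarrow> bool" where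
  "kac_automorphism I A D e k f \<longleftrightarrow>
     star_automorphism I A f \<and>
     (\<forall>x\<in>A. tensor_map A A f f (D x) = D (f x)) \<and>
     (\<forall>x\<in>A. e (f x) = e x) \<and>
     (\<forall>x\<in>A. f (k x) = k (f x))"


section \<open>The Kac algebra of a finite group\<close>

text \<open>The left regular representation: \<open>\<lambda>(g)\<close> maps the basis vector \<open>t\<close> to \<open>g t\<close>.\<close>

definition lreg :: "('a, 'b) monoid_scheme \<Rightarrow> 'a \<Rightarrow> 'a oper" where
  "lreg G g = (\<lambda>s t. if s \<in> carrier G \<and> t \<in> carrier G \<and> s = g \<otimes>\<^bsub>G\<^esub> t then 1 else 0)"

definition cstar_sub :: "('a, 'b) monoid_scheme \<Rightarrow> 'a set \<Rightarrow> 'a oper set" where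
  "cstar_sub G H = cstar_generated (carrier G) (lreg G ` H)"

abbreviation cstar :: "('a, 'b) monoid_scheme \<Rightarrow> 'a oper set" where
  "cstar G \<equiv> cstar_sub G (carrier G)"

abbreviation cstar2 :: "('a, 'b) monoid_scheme \<Rightarrow> ('a \<times> 'a) oper set" where
  "cstar2 G \<equiv> tensor_alg (cstar G) (cstar G)"

abbreviation cstar3 :: "('a, 'b) monoid_scheme \<Rightarrow> ('a \<times> 'a \<times> 'a) oper set" where
  "cstar3 G \<equiv> tensor_alg (cstar G) (cstar2 G)"

abbreviation carrier2 :: "('a, 'b) monoid_scheme \<Rightarrow> ('a \<times> 'a) set" where
  "carrier2 G \<equiv> carrier G \<times> carrier G"

abbreviation carrier3 :: "('a, 'b) monoid_scheme \<Rightarrow> ('a \<times> 'a \<times> 'a) set" where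
  "carrier3 G \<equiv> carrier G \<times> carrier G \<times> carrier G"

text \<open>
  The entry of \<open>x = \<Sum>\<^sub>g c\<^sub>g \<lambda>(g)\<close> at row \<open>g\<close> and column \<open>1\<close> is \<open>c\<^sub>g\<close>. Hence the following is the linear
  map on the \<open>C\<^sup>*\<close>-algebra of \<open>G\<close> that sends \<open>\<lambda>(g)\<close> to \<open>T g\<close>, and \<open>counit\<close> the one that
  sends \<open>\<lambda>(g)\<close> to \<open>1\<close>.
\<close>

definition lin_ext :: "('a, 'b) monoid_scheme \<Rightarrow> ('a \<Rightarrow> 'k oper) \<Rightarrow> 'a oper \<Rightarrow> 'k oper" where
  "lin_ext G T x = (\<lambda>p q. \<Sum>g\<in>carrier G. x g \<one>\<^bsub>G\<^esub> * T g p q)"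

definition coprod :: "('a, 'b) monoid_scheme \<Rightarrow> 'a oper \<Rightarrow> ('a \<times> 'a) oper" where
  "coprod G = lin_ext G (\<lambda>g. tensor (lreg G g) (lreg G g))"

definition counit :: "('a, 'b) monoid_scheme \<Rightarrow> 'a oper \<Rightarrow> complex" where
  "counit G x = (\<Sum>g\<in>carrier G. x g \<one>\<^bsub>G\<^esub>)"

definition antipode :: "('a, 'b) monoid_scheme \<Rightarrow> 'a oper \<Rightarrow> 'a oper" where
  "antipode G = lin_ext G (\<lambda>g. lreg G (inv\<^bsub>G\<^esub> g))"

definition aut_ext :: "('a, 'b) monoid_scheme \<Rightarrow> ('a \<Rightarrow> 'a) \<Rightarrow> 'a oper \<Rightarrow> 'a oper" where
  "aut_ext G \<alpha> = lin_ext G (\<lambda>g. lreg G (\<alpha> g))"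


section \<open>Twisting\<close>

definition coprod_left :: "('a, 'b) monoid_scheme \<Rightarrow> ('a \<times> 'a) oper \<Rightarrow> ('a \<times> 'a \<times> 'a) oper" where
  "coprod_left G X = assoc (tensor_map (cstar G) (cstar G) (coprod G) id X)"

definition coprod_right :: "('a, 'b) monoid_scheme \<Rightarrow> ('a \<times> 'a) oper \<Rightarrow> ('a \<times> 'a \<times> 'a) oper" where
  "coprod_right G X = tensor_map (cstar G) (cstar G) id (coprod G) X"

abbreviation tensor_one :: "('a, 'b) monoid_scheme \<Rightarrow> ('a \<times> 'a) oper \<Rightarrow> ('a \<times> 'a \<times> 'a) oper" where
  "tensor_one G X \<equiv> assoc (tensor X (op_one (carrier G)))"

abbreviation one_tensor :: "('a, 'b) monoid_scheme \<Rightarrow> ('a \<times> 'a) oper \<Rightarrow> ('a \<times> 'a \<times> 'a) oper" where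
  "one_tensor G X \<equiv> tensor (op_one (carrier G)) X"

definition two_cocycle :: "('a, 'b) monoid_scheme \<Rightarrow> ('a \<times> 'a) oper \<Rightarrow> bool" where
  "two_cocycle G \<Omega> \<longleftrightarrow>
     unitary_in (carrier2 G) (cstar2 G) \<Omega> \<and>
     tensor_one G \<Omega> \<star>\<^bsub>carrier3 G\<^esub> coprod_left G \<Omega> =
       one_tensor G \<Omega> \<star>\<^bsub>carrier3 G\<^esub> coprod_right G \<Omega>"

definition counital :: "('a, 'b) monoid_scheme \<Rightarrow> ('a \<times> 'a) oper \<Rightarrow> bool" where
  "counital G \<Omega> \<longleftrightarrow>
     slice_left (cstar G) (counit G) \<Omega> = op_one (carrier G) \<and>
     slice_right (cstar G) (counit G) \<Omega> = op_one (carrier G)"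

definition two_pseudo_cocycle :: "('a, 'b) monoid_scheme \<Rightarrow> ('a \<times> 'a) oper \<Rightarrow> bool" where
  "two_pseudo_cocycle G \<Omega> \<longleftrightarrow>
     unitary_in (carrier2 G) (cstar2 G) \<Omega> \<and>
     coprod_right G (adj \<Omega>) \<star>\<^bsub>carrier3 G\<^esub> one_tensor G (adj \<Omega>)
         \<star>\<^bsub>carrier3 G\<^esub> tensor_one G \<Omega> \<star>\<^bsub>carrier3 G\<^esub> coprod_left G \<Omega>
       \<in> commutant (carrier3 G) (cstar3 G) ((\<lambda>x. coprod_left G (coprod G x)) ` cstar G)"

definition twisted_coprod ::
  "('a, 'b) monoid_scheme \<Rightarrow> ('a \<times> 'a) oper \<Rightarrow> 'a oper \<Rightarrow> ('a \<times> 'a) oper" where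
  "twisted_coprod G \<Omega> x = \<Omega> \<star>\<^bsub>carrier2 G\<^esub> coprod G x \<star>\<^bsub>carrier2 G\<^esub> adj \<Omega>"

definition twisted_antipode :: "('a, 'b) monoid_scheme \<Rightarrow> 'a oper \<Rightarrow> 'a oper \<Rightarrow> 'a oper" where
  "twisted_antipode G u x = u \<star>\<^bsub>carrier G\<^esub> antipode G x \<star>\<^bsub>carrier G\<^esub> adj u"

text \<open>The element \<open>\<Omega>\<^sup>u = (u\<^sup>* \<otimes> u\<^sup>*) \<Omega> \<Delta>(u)\<close>.\<close>

definition gauge :: "('a, 'b) monoid_scheme \<Rightarrow> ('a \<times> 'a) oper \<Rightarrow> 'a oper \<Rightarrow> ('a \<times> 'a) oper" where
  "gauge G \<Omega> u = tensor (adj u) (adj u) \<star>\<^bsub>carrier2 G\<^esub> \<Omega> \<star>\<^bsub>carrier2 G\<^esub> coprod G u"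

definition flip_antipode :: "('a, 'b) monoid_scheme \<Rightarrow> ('a \<times> 'a) oper \<Rightarrow> ('a \<times> 'a) oper" where
  "flip_antipode G X = flip (tensor_map (cstar G) (cstar G) (antipode G) (antipode G) X)"

definition coprod_commutant :: "('a, 'b) monoid_scheme \<Rightarrow> ('a \<times> 'a) oper set" where
  "coprod_commutant G = commutant (carrier2 G) (cstar2 G) (coprod G ` cstar G)"

definition co_involutive :: "('a, 'b) monoid_scheme \<Rightarrow> ('a \<times> 'a) oper \<Rightarrow> 'a oper \<Rightarrow> bool" where
  "co_involutive G \<Omega> u \<longleftrightarrow>
     unitary_in (carrier G) (cstar G) u \<and> flip_antipode G (adj \<Omega>) = gauge G \<Omega> u"

definition pseudo_co_involutive ::
  "('a, 'b) monoid_scheme \<Rightarrow> ('a \<times> 'a) oper \<Rightarrow> 'a oper \<Rightarrow> bool" where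
  "pseudo_co_involutive G \<Omega> u \<longleftrightarrow>
     unitary_in (carrier G) (cstar G) u \<and>
     gauge G \<Omega> u \<star>\<^bsub>carrier2 G\<^esub> adj (flip_antipode G (adj \<Omega>)) \<in> coprod_commutant G"


section \<open>Lifting from an abelian subgroup\<close>

definition circle_group :: "complex monoid" where
  "circle_group = \<lparr>carrier = {z. cmod z = 1}, mult = (*), one = 1\<rparr>"

text \<open>Characters are made extensional, so that they are determined by their values on \<open>H\<close>.\<close>

definition dual_group :: "('a, 'b) monoid_scheme \<Rightarrow> 'a set \<Rightarrow> ('a \<Rightarrow> complex) set" where
  "dual_group G H = hom (G\<lparr>carrier := H\<rparr>) circle_group \<inter> extensional H"

definition spectral_projections ::
  "('a, 'b) monoid_scheme \<Rightarrow> 'a set \<Rightarrow> (('a \<Rightarrow> complex) \<Rightarrow> 'a oper) \<Rightarrow> bool" where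
  "spectral_projections G H P \<longleftrightarrow>
     (\<forall>x\<in>dual_group G H. P x \<in> cstar_sub G H \<and> adj (P x) = P x \<and> P x \<star>\<^bsub>carrier G\<^esub> P x = P x) \<and>
     (\<forall>x\<in>dual_group G H. \<forall>y\<in>dual_group G H. x \<noteq> y \<longrightarrow>
        P x \<star>\<^bsub>carrier G\<^esub> P y = (\<lambda>s t. 0)) \<and>
     (\<forall>h\<in>H. lreg G h = (\<lambda>s t. \<Sum>x\<in>dual_group G H. x h * P x s t))"

definition lifted_from :: "('a, 'b) monoid_scheme \<Rightarrow> 'a set \<Rightarrow> ('a \<times> 'a) oper \<Rightarrow> bool" where
  "lifted_from G H \<Omega> \<longleftrightarrow>
     (\<exists>P \<omega>. spectral_projections G H P \<and>
        (\<forall>x\<in>dual_group G H. \<forall>y\<in>dual_group G H. cmod (\<omega> x y) = 1) \<and>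
        \<Omega> = (\<lambda>p q. \<Sum>x\<in>dual_group G H. \<Sum>y\<in>dual_group G H. \<omega> x y * tensor (P x) (P y) p q))"

definition lifted_unitary :: "('a, 'b) monoid_scheme \<Rightarrow> ('a \<times> 'a) oper \<Rightarrow> 'a oper" where
  "lifted_unitary G \<Omega> =
     mult_map (carrier G) (cstar G) (tensor_map (cstar G) (cstar G) id (antipode G) \<Omega>)"

text \<open>
  The map \<open>\<alpha>\<^sup>-\<^sup>1 \<otimes> \<alpha>\<^sup>-\<^sup>1\<close>. If \<open>\<alpha>(H) = H\<close> it preserves the commutative algebra of \<open>H \<times> H\<close>,
  which contains \<open>\<Omega>\<close> and \<open>\<Omega>\<^sup>u\<close>; then the elements \<open>(\<alpha>\<^sup>-\<^sup>1 \<otimes> \<alpha>\<^sup>-\<^sup>1)(\<Omega>\<^sup>u)\<close> and \<open>\<Omega>\<^sup>*\<close> commute. For a general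
  automorphism \<open>\<alpha>\<close> of \<open>G\<close> they need not commute, and the order of the product
  \<open>(\<alpha>\<^sup>-\<^sup>1 \<otimes> \<alpha>\<^sup>-\<^sup>1)(\<Omega>\<^sup>u) \<Omega>\<^sup>*\<close> matters for its membership in the commutant of \<open>\<Delta>\<close>.
\<close>

definition aut_ext_inv2 ::
  "('a, 'b) monoid_scheme \<Rightarrow> ('a \<Rightarrow> 'a) \<Rightarrow> ('a \<times> 'a) oper \<Rightarrow> ('a \<times> 'a) oper" where
  "aut_ext_inv2 G \<alpha> X =
     (let \<beta> = aut_ext G (inv_into (carrier G) \<alpha>) in tensor_map (cstar G) (cstar G) \<beta> \<beta> X)"

end

theory Submission
  imports Defs
begin

text \<open>
  Write \<open>Z = \<Omega> \<Delta>(u)\<close>, so that \<open>\<Omega>\<^sup>u = (u \<otimes> u)\<^sup>* Z\<close>, and put \<open>C = \<Omega>\<^sup>* (\<alpha>\<^sup>-\<^sup>1 \<otimes> \<alpha>\<^sup>-\<^sup>1)(\<Omega>\<^sup>u)\<close>. Since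
  \<open>\<alpha> \<otimes> \<alpha>\<close> is multiplicative, \<open>Z = (u \<otimes> u) (\<alpha> \<otimes> \<alpha>)(\<Omega>) (\<alpha> \<otimes> \<alpha>)(C)\<close>. Now \<open>\<Delta>\<^sub>\<Omega>(\<gamma>(x))\<close> is the conjugate of
  \<open>\<Delta>(\<alpha>(x))\<close> by \<open>Z\<close>, and \<open>(\<gamma> \<otimes> \<gamma>)(\<Delta>\<^sub>\<Omega>(x))\<close> is its conjugate by \<open>(u \<otimes> u) (\<alpha> \<otimes> \<alpha>)(\<Omega>)\<close>. The two agree
  because \<open>C\<close> is a unitary in the commutant of \<open>\<Delta>\<close>, which makes \<open>(\<alpha> \<otimes> \<alpha>)(C)\<close> commute with
  \<open>\<Delta>(\<alpha>(x)) = (\<alpha> \<otimes> \<alpha>)(\<Delta>(x))\<close> (\<open>twisted_coprod_intertwined\<close>). The counit is multiplicative, hence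
  invariant under conjugation by \<open>u\<close>.

  For the antipode, \<open>\<alpha>(u) = u\<^sup>*\<close> gives \<open>\<gamma>(\<kappa>\<^sub>\<Omega>(x)) = u u\<^sup>* \<kappa>(\<alpha>(x)) u u\<^sup>* = \<kappa>(\<alpha>(x))\<close>, and \<open>\<kappa>(u) = u\<close> gives the
  same value for \<open>\<kappa>\<^sub>\<Omega>(\<gamma>(x)) = u \<kappa>(u\<^sup>*) \<kappa>(\<alpha>(x)) \<kappa>(u) u\<^sup>*\<close> (\<open>twisted_antipode_commute\<close>).

  That \<open>\<kappa>(u) = u\<close> for a counital cocycle is proved without Fourier transform on \<open>H\<close>
  (\<open>antipode_lifted_unitary\<close>). The map \<open>\<Phi>(a \<otimes> b \<otimes> c) = a \<kappa>(b) c\<close> is multiplicative on the threefold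
  tensor power of the commutative algebra of \<open>H\<close>. It sends \<open>\<Omega> \<otimes> 1\<close> to \<open>u\<close> and \<open>1 \<otimes> \<Omega>\<close> to \<open>\<kappa>(u)\<close>, while
  counitality makes it send \<open>(\<Delta> \<otimes> id)(\<Omega>)\<close> and \<open>(id \<otimes> \<Delta>)(\<Omega>)\<close> to \<open>1\<close>. Applied to the cocycle identity
  it yields \<open>u = \<kappa>(u)\<close>.

  Underneath, every algebra that occurs is a group algebra. The algebra of \<open>G\<close> consists of the
  translation invariant matrices (\<open>cstar_sub_eq\<close>), so an element is given by its column at the
  neutral element. Tensor powers are the algebras of the direct powers of \<open>G\<close>
  (\<open>tensor_alg_cstar\<close>), and a map induced on a tensor product by a bilinear map is the linear
  extension of its values on group elements (\<open>tensor_lift_eq_lin_ext\<close>). Thus \<open>\<Delta>\<close>, \<open>\<kappa>\<close>, \<open>\<alpha>\<close>, \<open>\<alpha> \<otimes> \<alpha>\<close>,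
  \<open>\<Delta> \<otimes> id\<close> and the like are all induced by maps between finite groups, and identities between
  their composites are checked on group elements.
\<close>

section \<open>Operators\<close>

lemma op_mult_assoc: "x \<star>\<^bsub>I\<^esub> y \<star>\<^bsub>I\<^esub> z = x \<star>\<^bsub>I\<^esub> (y \<star>\<^bsub>I\<^esub> z)"
proof (intro ext)
  fix i j
  have "(\<Sum>k\<in>I. (\<Sum>l\<in>I. x i l * y l k) * z k j) = (\<Sum>k\<in>I. \<Sum>l\<in>I. x i l * (y l k * z k j))"
    by (simp add: sum_distrib_right mult.assoc)
  also have "\<dots> = (\<Sum>l\<in>I. \<Sum>k\<in>I. x i l * (y l k * z k j))"
    by (rule sum.swap)
  finally show "(x \<star>\<^bsub>I\<^esub> y \<star>\<^bsub>I\<^esub> z) i j = (x \<star>\<^bsub>I\<^esub> (y \<star>\<^bsub>I\<^esub> z)) i j"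
    by (simp add: op_mult_def sum_distrib_left)
qed

lemma op_mult_one_left: "finite I \<Longrightarrow> x \<in> opers I \<Longrightarrow> op_one I \<star>\<^bsub>I\<^esub> x = x"
proof -
  assume I: "finite I" "x \<in> opers I"
  have "(\<Sum>k\<in>I. (if i \<in> I \<and> i = k then 1 else 0) * x k j) = (\<Sum>k\<in>I. if k = i then x k j else 0)" for i j
    by (rule sum.cong) auto
  then show ?thesis
    using I unfolding op_mult_def op_one_def opers_def by (auto intro!: ext simp: sum.delta)
qed

lemma op_mult_one_right: "finite I \<Longrightarrow> x \<in> opers I \<Longrightarrow> x \<star>\<^bsub>I\<^esub> op_one I = x"
proof -
  assume I: "finite I" "x \<in> opers I"
  have "(\<Sum>k\<in>I. x i k * (if k \<in> I \<and> k = j then 1 else 0)) = (\<Sum>k\<in>I. if k = j then x i k else 0)" for i j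
    by (rule sum.cong) auto
  then show ?thesis
    using I unfolding op_mult_def op_one_def opers_def by (auto intro!: ext simp: sum.delta)
qed

lemma op_mult_add_left: "op_add x y \<star>\<^bsub>I\<^esub> z = op_add (x \<star>\<^bsub>I\<^esub> z) (y \<star>\<^bsub>I\<^esub> z)"
  by (simp add: op_mult_def op_add_def sum.distrib distrib_right)

lemma op_mult_add_right: "z \<star>\<^bsub>I\<^esub> op_add x y = op_add (z \<star>\<^bsub>I\<^esub> x) (z \<star>\<^bsub>I\<^esub> y)"
  by (simp add: op_mult_def op_add_def sum.distrib distrib_left)

lemma op_mult_scale_left: "op_scale c x \<star>\<^bsub>I\<^esub> z = op_scale c (x \<star>\<^bsub>I\<^esub> z)"
  by (simp add: op_mult_def op_scale_def sum_distrib_left mult.assoc)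

lemma op_mult_scale_right: "z \<star>\<^bsub>I\<^esub> op_scale c x = op_scale c (z \<star>\<^bsub>I\<^esub> x)"
  by (simp add: op_mult_def op_scale_def sum_distrib_left mult.left_commute)

lemma adj_adj [simp]: "adj (adj x) = x"
  by (simp add: adj_def)

lemma adj_op_mult: "adj (x \<star>\<^bsub>I\<^esub> y) = adj y \<star>\<^bsub>I\<^esub> adj x"
  by (simp add: adj_def op_mult_def mult.commute)

lemma fd_cstar_algebraD:
  assumes "fd_cstar_algebra I A"
  shows "finite I" and "x \<in> A \<Longrightarrow> x \<in> opers I" and "op_one I \<in> A"
    and "x \<in> A \<Longrightarrow> y \<in> A \<Longrightarrow> op_add x y \<in> A"
    and "x \<in> A \<Longrightarrow> y \<in> A \<Longrightarrow> x \<star>\<^bsub>I\<^esub> y \<in> A"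
    and "x \<in> A \<Longrightarrow> op_scale c x \<in> A" and "x \<in> A \<Longrightarrow> adj x \<in> A"
  using assms unfolding fd_cstar_algebra_def by blast+

lemma star_homD:
  assumes "star_hom I A J B f"
  shows "x \<in> A \<Longrightarrow> f x \<in> B"
    and "x \<in> A \<Longrightarrow> y \<in> A \<Longrightarrow> f (op_add x y) = op_add (f x) (f y)"
    and "x \<in> A \<Longrightarrow> f (op_scale c x) = op_scale c (f x)"
    and "x \<in> A \<Longrightarrow> y \<in> A \<Longrightarrow> f (x \<star>\<^bsub>I\<^esub> y) = f x \<star>\<^bsub>J\<^esub> f y"
    and "x \<in> A \<Longrightarrow> f (adj x) = adj (f x)"
    and "f (op_one I) = op_one J"
  using assms unfolding star_hom_def by blast+

lemma fd_cstar_finite_sum: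
  assumes A: "fd_cstar_algebra I A" and "finite F" and "\<And>i. i \<in> F \<Longrightarrow> f i \<in> A"
  shows "(\<lambda>s t. \<Sum>i\<in>F. c i * f i s t) \<in> A"
  using assms(2,3)
proof (induction F rule: finite_induct)
  case empty
  have "op_scale 0 (op_one I) \<in> A"
    by (intro fd_cstar_algebraD[OF A])
  then show ?case
    by (simp add: op_scale_def)
next
  case (insert i F)
  then have "op_add (op_scale (c i) (f i)) (\<lambda>s t. \<Sum>i\<in>F. c i * f i s t) \<in> A"
    by (intro fd_cstar_algebraD[OF A]) auto
  then show ?case
    using insert by (simp add: op_add_def op_scale_def)
qed

lemma unitary_inD:
  assumes "unitary_in I A u"
  shows "u \<in> A" and "u \<star>\<^bsub>I\<^esub> adj u = op_one I" and "adj u \<star>\<^bsub>I\<^esub> u = op_one I"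
  using assms unfolding unitary_in_def by blast+

lemma unitary_in_adj:
  "fd_cstar_algebra I A \<Longrightarrow> unitary_in I A u \<Longrightarrow> unitary_in I A (adj u)"
  unfolding unitary_in_def by (auto simp: fd_cstar_algebraD)

lemma unitary_in_mult:
  assumes A: "fd_cstar_algebra I A" and u: "unitary_in I A u" and v: "unitary_in I A v"
  shows "unitary_in I A (u \<star>\<^bsub>I\<^esub> v)"
proof -
  note fd = fd_cstar_algebraD[OF A]
  have m: "u \<in> A" "v \<in> A" "adj u \<in> A" "adj v \<in> A"
    using u v by (auto simp: unitary_in_def fd)
  have "u \<star>\<^bsub>I\<^esub> v \<star>\<^bsub>I\<^esub> (adj v \<star>\<^bsub>I\<^esub> adj u) = u \<star>\<^bsub>I\<^esub> (v \<star>\<^bsub>I\<^esub> adj v) \<star>\<^bsub>I\<^esub> adj u"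
    by (simp only: op_mult_assoc)
  moreover have "adj v \<star>\<^bsub>I\<^esub> adj u \<star>\<^bsub>I\<^esub> (u \<star>\<^bsub>I\<^esub> v) = adj v \<star>\<^bsub>I\<^esub> (adj u \<star>\<^bsub>I\<^esub> u) \<star>\<^bsub>I\<^esub> v"
    by (simp only: op_mult_assoc)
  ultimately show ?thesis
    using u v m unfolding unitary_in_def
    by (auto simp: fd adj_op_mult op_mult_one_right)
qed

lemma unitary_in_star_hom:
  assumes f: "star_hom I A J B f" and A: "fd_cstar_algebra I A" and u: "unitary_in I A u"
  shows "unitary_in J B (f u)"
proof -
  note fd = fd_cstar_algebraD[OF A] and h = star_homD[OF f]
  have m: "u \<in> A" "adj u \<in> A"
    using u by (auto simp: unitary_in_def fd)
  show ?thesis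
    using u m h(1)[OF m(1)] unfolding unitary_in_def
    by (auto simp: h(5)[OF m(1), symmetric] h(4)[OF m(1) m(2), symmetric]
        h(4)[OF m(2) m(1), symmetric] h(6))
qed

lemma unitary_conj_mult:
  assumes A: "fd_cstar_algebra I A" and u: "unitary_in I A u" and x: "x \<in> A" and y: "y \<in> A"
  shows "(u \<star>\<^bsub>I\<^esub> x \<star>\<^bsub>I\<^esub> adj u) \<star>\<^bsub>I\<^esub> (u \<star>\<^bsub>I\<^esub> y \<star>\<^bsub>I\<^esub> adj u) = u \<star>\<^bsub>I\<^esub> (x \<star>\<^bsub>I\<^esub> y) \<star>\<^bsub>I\<^esub> adj u"
proof -
  have "(u \<star>\<^bsub>I\<^esub> x \<star>\<^bsub>I\<^esub> adj u) \<star>\<^bsub>I\<^esub> (u \<star>\<^bsub>I\<^esub> y \<star>\<^bsub>I\<^esub> adj u)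
      = u \<star>\<^bsub>I\<^esub> (x \<star>\<^bsub>I\<^esub> (adj u \<star>\<^bsub>I\<^esub> u)) \<star>\<^bsub>I\<^esub> y \<star>\<^bsub>I\<^esub> adj u"
    by (simp only: op_mult_assoc)
  also have "\<dots> = u \<star>\<^bsub>I\<^esub> x \<star>\<^bsub>I\<^esub> y \<star>\<^bsub>I\<^esub> adj u"
    using A u x by (simp add: unitary_inD op_mult_one_right fd_cstar_algebraD)
  finally show ?thesis
    by (simp only: op_mult_assoc)
qed

lemma unitary_conj_cancel:
  assumes A: "fd_cstar_algebra I A" and u: "unitary_in I A u" and x: "x \<in> A"
  shows "adj u \<star>\<^bsub>I\<^esub> (u \<star>\<^bsub>I\<^esub> x \<star>\<^bsub>I\<^esub> adj u) \<star>\<^bsub>I\<^esub> u = x"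
proof -
  have "adj u \<star>\<^bsub>I\<^esub> (u \<star>\<^bsub>I\<^esub> x \<star>\<^bsub>I\<^esub> adj u) \<star>\<^bsub>I\<^esub> u = (adj u \<star>\<^bsub>I\<^esub> u) \<star>\<^bsub>I\<^esub> x \<star>\<^bsub>I\<^esub> (adj u \<star>\<^bsub>I\<^esub> u)"
    by (simp only: op_mult_assoc)
  then show ?thesis
    using A u x by (simp add: unitary_inD op_mult_one_right op_mult_one_left fd_cstar_algebraD)
qed

lemma star_automorphism_unitary_conj:
  assumes A: "fd_cstar_algebra I A" and f: "star_automorphism I A f" and u: "unitary_in I A u"
  shows "star_automorphism I A (\<lambda>x. u \<star>\<^bsub>I\<^esub> f x \<star>\<^bsub>I\<^esub> adj u)"
proof -
  note fd = fd_cstar_algebraD[OF A]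
  have fh: "star_hom I A I A f" and fb: "bij_betw f A A"
    using f by (auto simp: star_automorphism_def)
  note h = star_homD[OF fh]
  have u': "unitary_in I A (adj u)"
    by (rule unitary_in_adj[OF A u])
  have uA: "u \<in> A" "adj u \<in> A"
    using u u' by (auto simp: unitary_in_def)
  have "bij_betw (\<lambda>x. u \<star>\<^bsub>I\<^esub> x \<star>\<^bsub>I\<^esub> adj u) A A"
    using unitary_conj_cancel[OF A u] unitary_conj_cancel[OF A u'] uA
    by (intro bij_betw_byWitness[where f' = "\<lambda>x. adj u \<star>\<^bsub>I\<^esub> x \<star>\<^bsub>I\<^esub> u"]) (auto simp: fd)
  then have "bij_betw (\<lambda>x. u \<star>\<^bsub>I\<^esub> f x \<star>\<^bsub>I\<^esub> adj u) A A"
    using bij_betw_trans[OF fb] by (simp add: comp_def)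
  moreover have "star_hom I A I A (\<lambda>x. u \<star>\<^bsub>I\<^esub> f x \<star>\<^bsub>I\<^esub> adj u)"
    unfolding star_hom_def
    using uA u
    by (auto simp: h fd op_mult_add_left op_mult_add_right op_mult_scale_left op_mult_scale_right
        adj_op_mult op_mult_assoc unitary_conj_mult[OF A u, unfolded op_mult_assoc]
        op_mult_one_left unitary_inD)
  ultimately show ?thesis
    by (simp add: star_automorphism_def)
qed

lemma tensor_mult:
  "tensor a b \<star>\<^bsub>I \<times> J\<^esub> tensor c d = tensor (a \<star>\<^bsub>I\<^esub> c) (b \<star>\<^bsub>J\<^esub> d)"
  unfolding tensor_def op_mult_def
  by (intro ext) (simp add: sum_product sum.cartesian_product case_prod_beta mult_ac)

lemma adj_tensor: "adj (tensor a b) = tensor (adj a) (adj b)"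
  by (simp add: adj_def tensor_def)

lemma tensor_op_one: "tensor (op_one I) (op_one J) = op_one (I \<times> J)"
  unfolding tensor_def op_one_def by (intro ext) auto


section \<open>Translation invariant operators\<close>

text \<open>
  The commutant of the right regular representation, cut down by a support condition: only
  entries \<open>(s, t)\<close> with \<open>s t\<^sup>-\<^sup>1 \<in> N\<close> may be nonzero. These conditions on entries replace the
  generated algebra in all computations.
\<close>

definition translation_invariant :: "('a, 'b) monoid_scheme \<Rightarrow> 'a set \<Rightarrow> 'a oper set" where
  "translation_invariant G N =
     {x \<in> opers (carrier G).
        (\<forall>s\<in>carrier G. \<forall>t\<in>carrier G. \<forall>g\<in>carrier G. x (s \<otimes>\<^bsub>G\<^esub> g) (t \<otimes>\<^bsub>G\<^esub> g) = x s t) \<and>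
        (\<forall>s\<in>carrier G. \<forall>t\<in>carrier G. x s t \<noteq> 0 \<longrightarrow> s \<otimes>\<^bsub>G\<^esub> inv\<^bsub>G\<^esub> t \<in> N)}"

locale finite_group = group G for G (structure) +
  assumes finite_carrier: "finite (carrier G)"

lemma finite_group_DirProd: "finite_group G \<Longrightarrow> finite_group K \<Longrightarrow> finite_group (G \<times>\<times> K)"
  by (simp add: finite_group_def finite_group_axioms_def DirProd_group)

lemma translation_invariantI:
  assumes "x \<in> opers (carrier G)"
    and "\<And>s t g. s \<in> carrier G \<Longrightarrow> t \<in> carrier G \<Longrightarrow> g \<in> carrier G \<Longrightarrow>
          x (s \<otimes>\<^bsub>G\<^esub> g) (t \<otimes>\<^bsub>G\<^esub> g) = x s t"
    and "\<And>s t. s \<in> carrier G \<Longrightarrow> t \<in> carrier G \<Longrightarrow> x s t \<noteq> 0 \<Longrightarrow> s \<otimes>\<^bsub>G\<^esub> inv\<^bsub>G\<^esub> t \<in> N"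
  shows "x \<in> translation_invariant G N"
  using assms by (simp add: translation_invariant_def)

lemma translation_invariantD:
  assumes "x \<in> translation_invariant G N"
  shows "x \<in> opers (carrier G)"
    and "s \<in> carrier G \<Longrightarrow> t \<in> carrier G \<Longrightarrow> g \<in> carrier G \<Longrightarrow>
          x (s \<otimes>\<^bsub>G\<^esub> g) (t \<otimes>\<^bsub>G\<^esub> g) = x s t"
    and "s \<in> carrier G \<Longrightarrow> t \<in> carrier G \<Longrightarrow> x s t \<noteq> 0 \<Longrightarrow> s \<otimes>\<^bsub>G\<^esub> inv\<^bsub>G\<^esub> t \<in> N"
  using assms by (simp_all add: translation_invariant_def)

lemma translation_invariant_sum:
  assumes "\<And>i. i \<in> F \<Longrightarrow> f i \<in> translation_invariant G N"
  shows "(\<lambda>s t. \<Sum>i\<in>F. c i * f i s t) \<in> translation_invariant G N"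
proof (rule translation_invariantI)
  show "(\<lambda>s t. \<Sum>i\<in>F. c i * f i s t) \<in> opers (carrier G)"
    using translation_invariantD(1)[OF assms] by (auto simp: opers_def intro!: sum.neutral)
next
  fix s t g assume "s \<in> carrier G" "t \<in> carrier G" "g \<in> carrier G"
  then show "(\<Sum>i\<in>F. c i * f i (s \<otimes>\<^bsub>G\<^esub> g) (t \<otimes>\<^bsub>G\<^esub> g)) = (\<Sum>i\<in>F. c i * f i s t)"
    using translation_invariantD(2)[OF assms] by (intro sum.cong) auto
next
  fix s t assume st: "s \<in> carrier G" "t \<in> carrier G" "(\<Sum>i\<in>F. c i * f i s t) \<noteq> 0"
  then obtain i where "i \<in> F" "c i * f i s t \<noteq> 0"
    by (meson sum.not_neutral_contains_not_neutral)
  then show "s \<otimes>\<^bsub>G\<^esub> inv\<^bsub>G\<^esub> t \<in> N"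
    using translation_invariantD(3)[OF assms st(1,2)] by auto
qed

lemma translation_invariant_sum_list:
  assumes "\<And>i. i \<in> set xs \<Longrightarrow> f i \<in> translation_invariant G N"
  shows "(\<lambda>s t. \<Sum>i\<leftarrow>xs. f i s t) \<in> translation_invariant G N"
  using translation_invariant_sum[of "{..<length xs}" "\<lambda>i. f (xs ! i)" G N "\<lambda>_. 1"] assms
  by (simp add: sum_list_sum_nth atLeast0LessThan)

lemma lin_ext_add: "lin_ext G T (op_add x y) = op_add (lin_ext G T x) (lin_ext G T y)"
  by (simp add: lin_ext_def op_add_def sum.distrib distrib_right)

lemma lin_ext_scale: "lin_ext G T (op_scale c x) = op_scale c (lin_ext G T x)"
  by (simp add: lin_ext_def op_scale_def sum_distrib_left mult.assoc)

context finite_group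
begin

lemma fd_cstar_translation_invariant:
  assumes N: "subgroup N G"
  shows "fd_cstar_algebra (carrier G) (translation_invariant G N)"
proof -
  interpret N: subgroup N G by (rule N)
  have one: "op_one (carrier G) \<in> translation_invariant G N"
    by (rule translation_invariantI) (auto simp: opers_def op_one_def split: if_splits)
  have add: "op_add x y \<in> translation_invariant G N"
    if x: "x \<in> translation_invariant G N" and y: "y \<in> translation_invariant G N" for x y
    using translation_invariant_sum[of "{False, True}" "\<lambda>b. if b then x else y" G N "\<lambda>_. 1"] x y
    by (simp add: op_add_def add.commute)
  have scale: "op_scale c x \<in> translation_invariant G N"
    if x: "x \<in> translation_invariant G N" for x c
    using translation_invariant_sum[of "{()}" "\<lambda>b. x" G N "\<lambda>_. c"] x
    by (simp add: op_scale_def)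
  have ad: "adj x \<in> translation_invariant G N" if x: "x \<in> translation_invariant G N" for x
  proof (rule translation_invariantI)
    show "adj x \<in> opers (carrier G)"
      using translation_invariantD(1)[OF x] by (auto simp: opers_def adj_def)
    show "adj x (s \<otimes> g) (t \<otimes> g) = adj x s t"
      if "s \<in> carrier G" "t \<in> carrier G" "g \<in> carrier G" for s t g
      using translation_invariantD(2)[OF x] that by (auto simp: adj_def)
    show "s \<otimes> inv t \<in> N" if st: "s \<in> carrier G" "t \<in> carrier G" "adj x s t \<noteq> 0" for s t
      using N.m_inv_closed[OF translation_invariantD(3)[OF x st(2,1)]] st
      by (auto simp: adj_def inv_mult_group)
  qed
  have mult: "x \<star>\<^bsub>carrier G\<^esub> y \<in> translation_invariant G N"
    if x: "x \<in> translation_invariant G N" and y: "y \<in> translation_invariant G N" for x y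
  proof (rule translation_invariantI)
    show "x \<star>\<^bsub>carrier G\<^esub> y \<in> opers (carrier G)"
      using translation_invariantD(1)[OF x] translation_invariantD(1)[OF y]
      by (auto simp: opers_def op_mult_def)
  next
    fix s t g assume c: "s \<in> carrier G" "t \<in> carrier G" "g \<in> carrier G"
    have "x s (k \<otimes> inv g) * y (k \<otimes> inv g) t = x (s \<otimes> g) k * y k (t \<otimes> g)" if k: "k \<in> carrier G" for k
      using translation_invariantD(2)[OF x, of s "k \<otimes> inv g" g]
        translation_invariantD(2)[OF y, of "k \<otimes> inv g" t g] c k
      by (simp add: m_assoc)
    then show "(x \<star>\<^bsub>carrier G\<^esub> y) (s \<otimes> g) (t \<otimes> g) = (x \<star>\<^bsub>carrier G\<^esub> y) s t"
      unfolding op_mult_def using c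
      by (intro sum.reindex_bij_witness[where i = "\<lambda>k. k \<otimes> g" and j = "\<lambda>k. k \<otimes> inv g"])
        (auto simp: m_assoc)
  next
    fix s t assume c: "s \<in> carrier G" "t \<in> carrier G" "(x \<star>\<^bsub>carrier G\<^esub> y) s t \<noteq> 0"
    then obtain k where k: "k \<in> carrier G" "x s k * y k t \<noteq> 0"
      unfolding op_mult_def by (meson sum.not_neutral_contains_not_neutral)
    have "(s \<otimes> inv k) \<otimes> (k \<otimes> inv t) \<in> N"
      using translation_invariantD(3)[OF x, of s k] translation_invariantD(3)[OF y, of k t] c k
      by auto
    also have "(s \<otimes> inv k) \<otimes> (k \<otimes> inv t) = s \<otimes> inv t"
      using c k by (metis inv_closed m_assoc m_closed l_inv l_one)
    finally show "s \<otimes> inv t \<in> N" .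
  qed
  show ?thesis
    unfolding fd_cstar_algebra_def
    by (intro conjI ballI allI subsetI finite_carrier one add scale ad mult)
      (rule translation_invariantD(1))
qed

text \<open>
  The column at the neutral element determines \<open>x\<close>. It is the coefficient function of \<open>x\<close> with
  respect to the regular representation, which is what \<open>lin_ext\<close> reads off.
\<close>

lemma translation_invariant_entry:
  assumes "x \<in> translation_invariant G N" "s \<in> carrier G" "t \<in> carrier G"
  shows "x (s \<otimes> inv t) \<one> = x s t"
  using translation_invariantD(2)[OF assms, of "inv t"] assms by simp

lemma translation_invariant_coeff:
  assumes "x \<in> translation_invariant G N" "g \<in> carrier G" "x g \<one> \<noteq> 0"
  shows "g \<in> N"
  using translation_invariantD(3)[OF assms(1,2), of \<one>] assms by simp

lemma lreg_translation_invariant: "subgroup N G \<Longrightarrow> g \<in> N \<Longrightarrow> lreg G g \<in> translation_invariant G N"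
proof (rule translation_invariantI)
  assume N: "subgroup N G" "g \<in> N"
  then have g: "g \<in> carrier G"
    by (rule subgroup.mem_carrier)
  show "lreg G g \<in> opers (carrier G)"
    by (auto simp: opers_def lreg_def)
  show "lreg G g (s \<otimes> k) (t \<otimes> k) = lreg G g s t"
    if "s \<in> carrier G" "t \<in> carrier G" "k \<in> carrier G" for s t k
    using that g by (auto simp: lreg_def m_assoc[symmetric])
  show "s \<otimes> inv t \<in> N" if "s \<in> carrier G" "t \<in> carrier G" "lreg G g s t \<noteq> 0" for s t
    using that g N by (auto simp: lreg_def m_assoc split: if_splits)
qed

lemma lin_ext_lreg_self:
  assumes x: "x \<in> translation_invariant G N"
  shows "lin_ext G (lreg G) x = x"
proof (intro ext)
  fix s t
  show "lin_ext G (lreg G) x s t = x s t"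
  proof (cases "s \<in> carrier G \<and> t \<in> carrier G")
    case True
    have "lin_ext G (lreg G) x s t = (\<Sum>g\<in>carrier G. if g = s \<otimes> inv t then x g \<one> else 0)"
      unfolding lin_ext_def lreg_def using True
      by (intro sum.cong) (auto simp: m_assoc)
    also have "\<dots> = x s t"
      using True finite_carrier translation_invariant_entry[OF x] by (simp add: sum.delta)
    finally show ?thesis .
  next
    case False
    then have "x s t = 0"
      using translation_invariantD(1)[OF x] by (auto simp: opers_def)
    moreover have "lin_ext G (lreg G) x s t = 0"
      using False by (auto simp: lin_ext_def lreg_def)
    ultimately show ?thesis
      by simp
  qed
qed

lemma lin_ext_lreg:
  assumes "g \<in> carrier G"
  shows "lin_ext G T (lreg G g) = T g"
proof (intro ext)
  fix p q
  have "lin_ext G T (lreg G g) p q = (\<Sum>k\<in>carrier G. if k = g then T k p q else 0)"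
    unfolding lin_ext_def lreg_def using assms by (intro sum.cong) auto
  then show "lin_ext G T (lreg G g) p q = T g p q"
    using assms finite_carrier by (simp add: sum.delta)
qed

text \<open>
  Translation invariant operators supported on \<open>N\<close> form an algebra that contains the generators;
  conversely each of them is the combination of the generators given by its first column.
\<close>

lemma cstar_sub_eq:
  assumes N: "subgroup N G"
  shows "cstar_sub G N = translation_invariant G N"
proof
  show "cstar_sub G N \<subseteq> translation_invariant G N"
    unfolding cstar_sub_def cstar_generated_def
    using fd_cstar_translation_invariant[OF N] lreg_translation_invariant[OF N] by blast
  show "translation_invariant G N \<subseteq> cstar_sub G N"
  proof
    fix x assume x: "x \<in> translation_invariant G N"
    have "x \<in> A" if A: "fd_cstar_algebra (carrier G) A" "lreg G ` N \<subseteq> A" for A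
    proof -
      have "(\<lambda>s t. \<Sum>g\<in>N. x g \<one> * lreg G g s t) \<in> A"
        using A finite_subset[OF subgroup.subset[OF N] finite_carrier]
        by (intro fd_cstar_finite_sum) auto
      also have "(\<lambda>s t. \<Sum>g\<in>N. x g \<one> * lreg G g s t) = lin_ext G (lreg G) x"
        unfolding lin_ext_def using subgroup.subset[OF N] finite_carrier
        by (intro ext sum.mono_neutral_left) (auto dest: translation_invariant_coeff[OF x])
      finally show ?thesis
        by (simp add: lin_ext_lreg_self[OF x])
    qed
    then show "x \<in> cstar_sub G N"
      by (auto simp: cstar_sub_def cstar_generated_def)
  qed
qed

lemmas cstar_eq = cstar_sub_eq[OF subgroup_self]

lemma fd_cstar_cstar: "fd_cstar_algebra (carrier G) (cstar G)"
  by (simp add: cstar_eq fd_cstar_translation_invariant[OF subgroup_self])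

lemma lreg_in_cstar: "g \<in> carrier G \<Longrightarrow> lreg G g \<in> cstar G"
  by (simp add: cstar_eq lreg_translation_invariant[OF subgroup_self])

lemma lreg_mult:
  assumes "g \<in> carrier G" "h \<in> carrier G"
  shows "lreg G g \<star>\<^bsub>carrier G\<^esub> lreg G h = lreg G (g \<otimes> h)"
proof (intro ext)
  fix s t
  have "(lreg G g \<star>\<^bsub>carrier G\<^esub> lreg G h) s t
      = (\<Sum>k\<in>carrier G. if k = h \<otimes> t then lreg G (g \<otimes> h) s t else 0)"
    unfolding op_mult_def lreg_def using assms by (intro sum.cong) (auto simp: m_assoc)
  then show "(lreg G g \<star>\<^bsub>carrier G\<^esub> lreg G h) s t = lreg G (g \<otimes> h) s t"
    using assms finite_carrier by (auto simp: sum.delta lreg_def)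
qed

lemma lreg_one: "lreg G \<one> = op_one (carrier G)"
  unfolding lreg_def op_one_def by (intro ext) auto

lemma adj_lreg: "g \<in> carrier G \<Longrightarrow> adj (lreg G g) = lreg G (inv g)"
  unfolding lreg_def adj_def by (intro ext) (auto simp: inv_solve_left)

text \<open>
  The product of two group algebra elements is the convolution of their coefficient functions.
  Multiplicativity of \<open>T\<close> and \<open>S\<close> is asked for on \<open>N\<close> alone, where the coefficients live. This is
  how commutativity of the subgroup enters: \<open>(a, b, c) \<mapsto> a b\<^sup>-\<^sup>1 c\<close> is multiplicative on an abelian
  subgroup.
\<close>

lemma lin_ext_mult:
  assumes N: "subgroup N G"
    and x: "x \<in> translation_invariant G N" and y: "y \<in> translation_invariant G N"
    and T: "\<And>g h. g \<in> N \<Longrightarrow> h \<in> N \<Longrightarrow> T g \<star>\<^bsub>J\<^esub> S h = R (g \<otimes> h)"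
  shows "lin_ext G T x \<star>\<^bsub>J\<^esub> lin_ext G S y = lin_ext G R (x \<star>\<^bsub>carrier G\<^esub> y)"
proof (intro ext)
  fix p q
  have "(lin_ext G T x \<star>\<^bsub>J\<^esub> lin_ext G S y) p q
      = (\<Sum>r\<in>J. \<Sum>g\<in>carrier G. \<Sum>h\<in>carrier G. x g \<one> * y h \<one> * (T g p r * S h r q))"
    unfolding op_mult_def lin_ext_def sum_product by (simp add: mult_ac)
  also have "\<dots> = (\<Sum>g\<in>carrier G. \<Sum>r\<in>J. \<Sum>h\<in>carrier G. x g \<one> * y h \<one> * (T g p r * S h r q))"
    by (rule sum.swap)
  also have "\<dots> = (\<Sum>g\<in>carrier G. \<Sum>h\<in>carrier G. \<Sum>r\<in>J. x g \<one> * y h \<one> * (T g p r * S h r q))"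
    by (intro sum.cong[OF refl] sum.swap)
  also have "\<dots> = (\<Sum>g\<in>carrier G. \<Sum>h\<in>carrier G. x g \<one> * y h \<one> * (T g \<star>\<^bsub>J\<^esub> S h) p q)"
    by (simp add: op_mult_def sum_distrib_left)
  also have "\<dots> = (\<Sum>g\<in>carrier G. \<Sum>h\<in>carrier G. x g \<one> * y h \<one> * R (g \<otimes> h) p q)"
    using translation_invariant_coeff[OF x] translation_invariant_coeff[OF y] T
    by (intro sum.cong[OF refl]) (metis mult_zero_left mult_zero_right)
  also have "\<dots> = (\<Sum>h\<in>carrier G. \<Sum>g\<in>carrier G. x g \<one> * y h \<one> * R (g \<otimes> h) p q)"
    by (rule sum.swap)
  also have "\<dots> = (\<Sum>h\<in>carrier G. \<Sum>m\<in>carrier G. x m h * y h \<one> * R m p q)"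
  proof (rule sum.cong[OF refl])
    fix h assume h: "h \<in> carrier G"
    show "(\<Sum>g\<in>carrier G. x g \<one> * y h \<one> * R (g \<otimes> h) p q) = (\<Sum>m\<in>carrier G. x m h * y h \<one> * R m p q)"
      using h translation_invariantD(2)[OF x, of _ \<one> h]
      by (intro sum.reindex_bij_witness[where j = "\<lambda>g. g \<otimes> h" and i = "\<lambda>m. m \<otimes> inv h"])
        (auto simp: m_assoc)
  qed
  also have "\<dots> = (\<Sum>m\<in>carrier G. \<Sum>h\<in>carrier G. x m h * y h \<one> * R m p q)"
    by (rule sum.swap)
  also have "\<dots> = lin_ext G R (x \<star>\<^bsub>carrier G\<^esub> y) p q"
    by (simp add: lin_ext_def op_mult_def sum_distrib_right)
  finally show "(lin_ext G T x \<star>\<^bsub>J\<^esub> lin_ext G S y) p q = lin_ext G R (x \<star>\<^bsub>carrier G\<^esub> y) p q" .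
qed

lemma lin_ext_cong:
  assumes x: "x \<in> translation_invariant G N" and T: "\<And>g. g \<in> N \<Longrightarrow> g \<in> carrier G \<Longrightarrow> T g = S g"
  shows "lin_ext G T x = lin_ext G S x"
  unfolding lin_ext_def
  using translation_invariant_coeff[OF x] T by (intro ext sum.cong[OF refl]) (metis mult_zero_left)

lemmas lin_ext_cong_cstar = lin_ext_cong[where N = "carrier G", folded cstar_eq]

lemma lin_ext_in_translation_invariant:
  assumes x: "x \<in> translation_invariant G N"
    and T: "\<And>g. g \<in> N \<Longrightarrow> g \<in> carrier G \<Longrightarrow> T g \<in> translation_invariant K M"
  shows "lin_ext G T x \<in> translation_invariant K M"
proof -
  have "lin_ext G T x = lin_ext G (\<lambda>g. if g \<in> N then T g else (\<lambda>p q. 0)) x"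
    by (rule lin_ext_cong[OF x]) auto
  also have "\<dots> \<in> translation_invariant K M"
    unfolding lin_ext_def using T
    by (intro translation_invariant_sum) (auto simp: translation_invariant_def opers_def)
  finally show ?thesis .
qed

end


section \<open>Linear extension\<close>

definition linear_on :: "'i oper set \<Rightarrow> ('i oper \<Rightarrow> 'j oper) \<Rightarrow> bool" where
  "linear_on A f \<longleftrightarrow>
     (\<forall>x\<in>A. \<forall>y\<in>A. f (op_add x y) = op_add (f x) (f y)) \<and>
     (\<forall>c. \<forall>x\<in>A. f (op_scale c x) = op_scale c (f x))"

lemma linear_on_lin_ext: "linear_on A (lin_ext G T)"
  by (simp add: linear_on_def lin_ext_add lin_ext_scale)

lemma linear_on_id: "linear_on A id"
  by (simp add: linear_on_def)

lemma linear_on_op_mult_left: "linear_on A f \<Longrightarrow> linear_on A (\<lambda>x. a \<star>\<^bsub>I\<^esub> f x)"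
  by (simp add: linear_on_def op_mult_add_right op_mult_scale_right)

lemma linear_on_op_mult_right: "linear_on A f \<Longrightarrow> linear_on A (\<lambda>x. f x \<star>\<^bsub>I\<^esub> a)"
  by (simp add: linear_on_def op_mult_add_left op_mult_scale_left)

lemma linear_on_tensor_left: "linear_on A f \<Longrightarrow> linear_on A (\<lambda>x. tensor (f x) b)"
  by (simp add: linear_on_def tensor_def op_add_def op_scale_def algebra_simps)

lemma linear_on_tensor_right: "linear_on A f \<Longrightarrow> linear_on A (\<lambda>x. tensor b (f x))"
  by (simp add: linear_on_def tensor_def op_add_def op_scale_def algebra_simps)

lemma linear_on_assoc: "linear_on A f \<Longrightarrow> linear_on A (\<lambda>x. assoc (f x))"
  by (auto simp: linear_on_def assoc_def op_add_def op_scale_def intro!: ext)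

context finite_group
begin

text \<open>
  The regular representation spans the algebra, so a linear map is determined by its values
  there. Most identities between linear maps below are obtained from this.
\<close>

lemma linear_on_cstar_eq_lin_ext:
  assumes f: "linear_on (cstar G) f" and x: "x \<in> cstar G"
  shows "f x = lin_ext G (\<lambda>g. f (lreg G g)) x"
proof -
  note fd = fd_cstar_algebraD[OF fd_cstar_cstar]
  have add: "f (op_add a b) = op_add (f a) (f b)" if "a \<in> cstar G" "b \<in> cstar G" for a b
    using f that by (simp add: linear_on_def)
  have scale: "f (op_scale c a) = op_scale c (f a)" if "a \<in> cstar G" for a c
    using f that by (simp add: linear_on_def)
  have sum: "f (\<lambda>s t. \<Sum>g\<in>F. c g * lreg G g s t) = (\<lambda>p q. \<Sum>g\<in>F. c g * f (lreg G g) p q)"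
    if "finite F" "F \<subseteq> carrier G" for F c
    using that
  proof (induction F rule: finite_induct)
    case empty
    show ?case
      using scale[OF fd(3), of 0] by (simp add: op_scale_def)
  next
    case (insert g F)
    then have F: "(\<lambda>s t. \<Sum>g\<in>F. c g * lreg G g s t) \<in> cstar G"
      by (intro fd_cstar_finite_sum[OF fd_cstar_cstar]) (auto simp: lreg_in_cstar)
    have g: "lreg G g \<in> cstar G"
      using insert by (simp add: lreg_in_cstar)
    have "f (\<lambda>s t. \<Sum>g\<in>insert g F. c g * lreg G g s t)
        = f (op_add (op_scale (c g) (lreg G g)) (\<lambda>s t. \<Sum>g\<in>F. c g * lreg G g s t))"
      using insert by (simp add: op_add_def op_scale_def)
    also have "\<dots> = op_add (op_scale (c g) (f (lreg G g))) (\<lambda>p q. \<Sum>g\<in>F. c g * f (lreg G g) p q)"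
      using insert by (simp add: add[OF fd(6)[OF g] F] scale[OF g])
    finally show ?case
      using insert by (simp add: op_add_def op_scale_def)
  qed
  have "f x = f (lin_ext G (lreg G) x)"
    using x by (simp add: cstar_eq lin_ext_lreg_self)
  also have "\<dots> = lin_ext G (\<lambda>g. f (lreg G g)) x"
    using sum[OF finite_carrier subset_refl, of "\<lambda>g. x g \<one>"] by (simp add: lin_ext_def)
  finally show ?thesis .
qed

lemma linear_on_lin_ext_comp:
  assumes f: "linear_on (cstar K) f" and K: "finite_group K" and x: "x \<in> cstar G"
    and \<phi>: "\<And>g. g \<in> carrier G \<Longrightarrow> \<phi> g \<in> carrier K"
  shows "f (lin_ext G (\<lambda>g. lreg K (\<phi> g)) x) = lin_ext G (\<lambda>g. f (lreg K (\<phi> g))) x"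
proof -
  interpret K: finite_group K by (rule K)
  have in_K: "lin_ext G (\<lambda>g. lreg K (\<phi> g)) a \<in> cstar K" if "a \<in> cstar G" for a
    using that \<phi> unfolding cstar_eq K.cstar_eq
    by (intro lin_ext_in_translation_invariant K.lreg_translation_invariant K.subgroup_self) auto
  have "linear_on (cstar G) (\<lambda>x. f (lin_ext G (\<lambda>g. lreg K (\<phi> g)) x))"
    using f in_K by (simp add: linear_on_def lin_ext_add lin_ext_scale)
  from linear_on_cstar_eq_lin_ext[OF this x]
  have "f (lin_ext G (\<lambda>g. lreg K (\<phi> g)) x) = lin_ext G (\<lambda>g. f (lin_ext G (\<lambda>g. lreg K (\<phi> g)) (lreg G g))) x" .
  also have "\<dots> = lin_ext G (\<lambda>g. f (lreg K (\<phi> g))) x"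
    using x by (intro lin_ext_cong_cstar) (auto simp: lin_ext_lreg)
  finally show ?thesis .
qed

end


section \<open>Homomorphisms of group algebras\<close>

text \<open>
  The linear map induced by \<open>\<phi>\<close>. It is used for homomorphisms, where it is a \<open>*\<close>-homomorphism,
  and also for other maps of groups such as the inversion.
\<close>

definition group_map ::
  "('a, 'b) monoid_scheme \<Rightarrow> ('c, 'd) monoid_scheme \<Rightarrow> ('a \<Rightarrow> 'c) \<Rightarrow> 'a oper \<Rightarrow> 'c oper" where
  "group_map G K \<phi> = lin_ext G (\<lambda>g. lreg K (\<phi> g))"

locale finite_group_pair = finite_group G + K: finite_group K for G (structure) and K (structure)
begin

lemma group_map_in:
  assumes "x \<in> translation_invariant G N" "subgroup M K" "\<And>g. g \<in> N \<Longrightarrow> \<phi> g \<in> M"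
  shows "group_map G K \<phi> x \<in> translation_invariant K M"
  unfolding group_map_def using assms
  by (intro lin_ext_in_translation_invariant K.lreg_translation_invariant) auto

text \<open>
  Functoriality, for arbitrary maps \<open>\<phi>\<close> of the underlying sets. It computes all composites of
  structure maps.
\<close>

lemma lin_ext_group_map:
  assumes x: "x \<in> cstar G" and \<phi>: "\<And>g. g \<in> carrier G \<Longrightarrow> \<phi> g \<in> carrier K"
  shows "lin_ext K T (group_map G K \<phi> x) = lin_ext G (\<lambda>g. T (\<phi> g)) x"
proof -
  have "lin_ext K T (group_map G K \<phi> x) = lin_ext G (\<lambda>g. lin_ext K T (lreg K (\<phi> g))) x"
    unfolding group_map_def
    by (rule linear_on_lin_ext_comp[OF linear_on_lin_ext K.finite_group_axioms x \<phi>])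
  also have "\<dots> = lin_ext G (\<lambda>g. T (\<phi> g)) x"
    using x \<phi> by (intro lin_ext_cong_cstar) (auto simp: K.lin_ext_lreg)
  finally show ?thesis .
qed

lemma group_map_comp:
  assumes "x \<in> cstar G" "\<And>g. g \<in> carrier G \<Longrightarrow> \<phi> g \<in> carrier K"
  shows "group_map K L \<psi> (group_map G K \<phi> x) = group_map G L (\<lambda>g. \<psi> (\<phi> g)) x"
  unfolding group_map_def[of K] group_map_def[of G L] using assms by (rule lin_ext_group_map)

lemma star_hom_group_map:
  assumes \<phi>: "\<phi> \<in> hom G K"
  shows "star_hom (carrier G) (cstar G) (carrier K) (cstar K) (group_map G K \<phi>)"
proof -
  have c: "\<phi> g \<in> carrier K" if "g \<in> carrier G" for g
    using \<phi> that by (auto simp: hom_def)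
  have m: "\<phi> (g \<otimes> h) = \<phi> g \<otimes>\<^bsub>K\<^esub> \<phi> h" if "g \<in> carrier G" "h \<in> carrier G" for g h
    using \<phi> that by (auto simp: hom_def)
  interpret hom: group_hom G K \<phi>
    by unfold_locales (rule \<phi>)
  have ad: "group_map G K \<phi> (adj x) = adj (group_map G K \<phi> x)" if x: "x \<in> cstar G" for x
  proof (intro ext)
    fix p q
    have cnj: "adj x g \<one> = cnj (x (inv g) \<one>)" if "g \<in> carrier G" for g
      using translation_invariant_entry[of x "carrier G" \<one> g] x that by (simp add: adj_def cstar_eq)
    have adl: "cnj (lreg K (\<phi> g) q p) = lreg K (\<phi> (inv g)) p q" if "g \<in> carrier G" for g
      using K.adj_lreg[OF c[OF that]] that by (simp add: adj_def fun_eq_iff)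
    have "adj (group_map G K \<phi> x) p q = (\<Sum>g\<in>carrier G. cnj (x g \<one>) * lreg K (\<phi> (inv g)) p q)"
      by (simp add: adj_def group_map_def lin_ext_def adl)
    also have "\<dots> = (\<Sum>g\<in>carrier G. adj x g \<one> * lreg K (\<phi> g) p q)"
      by (rule sum.reindex_bij_witness[where i = "\<lambda>g. inv g" and j = "\<lambda>g. inv g"]) (auto simp: cnj)
    finally show "group_map G K \<phi> (adj x) p q = adj (group_map G K \<phi> x) p q"
      by (simp add: group_map_def lin_ext_def)
  qed
  have "group_map G K \<phi> (op_one (carrier G)) = op_one (carrier K)"
    using lin_ext_lreg[OF one_closed, of "\<lambda>g. lreg K (\<phi> g)"]
    by (simp add: group_map_def lreg_one K.lreg_one)
  moreover have "group_map G K \<phi> x \<star>\<^bsub>carrier K\<^esub> group_map G K \<phi> y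
      = group_map G K \<phi> (x \<star>\<^bsub>carrier G\<^esub> y)" if "x \<in> cstar G" "y \<in> cstar G" for x y
    unfolding group_map_def using that
    by (intro lin_ext_mult[OF subgroup_self]) (auto simp: cstar_eq K.lreg_mult c m)
  moreover have "group_map G K \<phi> x \<in> cstar K" if "x \<in> cstar G" for x
    using that c unfolding cstar_eq K.cstar_eq by (intro group_map_in K.subgroup_self) auto
  ultimately show ?thesis
    unfolding star_hom_def using ad by (auto simp: group_map_def lin_ext_add lin_ext_scale)
qed

end

lemma (in finite_group) group_map_id:
  assumes "x \<in> cstar G" "\<And>g. g \<in> carrier G \<Longrightarrow> \<phi> g = g"
  shows "group_map G G \<phi> x = x"
proof -
  have "group_map G G \<phi> x = lin_ext G (lreg G) x"
    unfolding group_map_def using assms by (intro lin_ext_cong_cstar) auto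
  then show ?thesis
    using assms by (simp add: lin_ext_lreg_self cstar_eq)
qed

lemma (in finite_group) star_automorphism_group_map:
  assumes \<phi>: "\<phi> \<in> hom G G" "bij_betw \<phi> (carrier G) (carrier G)"
  shows "star_automorphism (carrier G) (cstar G) (group_map G G \<phi>)"
proof -
  interpret P: finite_group_pair G G ..
  let ?\<psi> = "inv_into (carrier G) \<phi>"
  have c: "\<phi> g \<in> carrier G" "?\<psi> g \<in> carrier G" if "g \<in> carrier G" for g
    using bij_betwE[OF \<phi>(2)] bij_betwE[OF bij_betw_inv_into[OF \<phi>(2)]] that by auto
  have \<psi>in: "group_map G G ?\<psi> x \<in> cstar G" if "x \<in> cstar G" for x
    using that c unfolding cstar_eq by (intro P.group_map_in subgroup_self) auto
  have inv1: "group_map G G ?\<psi> (group_map G G \<phi> x) = x" if x: "x \<in> cstar G" for x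
    using group_map_id[OF x, of "\<lambda>g. ?\<psi> (\<phi> g)"] bij_betw_inv_into_left[OF \<phi>(2)]
    by (simp add: P.group_map_comp[OF x c(1)])
  have inv2: "group_map G G \<phi> (group_map G G ?\<psi> x) = x" if x: "x \<in> cstar G" for x
    using group_map_id[OF x, of "\<lambda>g. \<phi> (?\<psi> g)"] bij_betw_inv_into_right[OF \<phi>(2)]
    by (simp add: P.group_map_comp[OF x c(2)])
  have "bij_betw (group_map G G \<phi>) (cstar G) (cstar G)"
    using inv1 inv2 \<psi>in star_homD(1)[OF P.star_hom_group_map[OF \<phi>(1)]]
    by (intro bij_betw_byWitness[where f' = "group_map G G ?\<psi>"]) auto
  then show ?thesis
    using P.star_hom_group_map[OF \<phi>(1)] by (simp add: star_automorphism_def)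
qed


section \<open>Tensor products\<close>

lemma tensor_lreg: "tensor (lreg G g) (lreg K h) = lreg (G \<times>\<times> K) (g, h)"
proof (intro ext)
  fix p q
  show "tensor (lreg G g) (lreg K h) p q = lreg (G \<times>\<times> K) (g, h) p q"
    by (cases p; cases q) (auto simp: tensor_def lreg_def)
qed

context finite_group_pair
begin

lemma finite_group_prod: "finite_group (G \<times>\<times> K)"
  by (rule finite_group_DirProd[OF finite_group_axioms K.finite_group_axioms])

lemma tensor_translation_invariant:
  assumes a: "a \<in> translation_invariant G N" and b: "b \<in> translation_invariant K M"
  shows "tensor a b \<in> translation_invariant (G \<times>\<times> K) (N \<times> M)"
proof (rule translation_invariantI)
  show "tensor a b \<in> opers (carrier (G \<times>\<times> K))"
    using translation_invariantD(1)[OF a] translation_invariantD(1)[OF b]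
    by (auto simp: opers_def tensor_def)
  show "tensor a b (s \<otimes>\<^bsub>G \<times>\<times> K\<^esub> g) (t \<otimes>\<^bsub>G \<times>\<times> K\<^esub> g) = tensor a b s t"
    if "s \<in> carrier (G \<times>\<times> K)" "t \<in> carrier (G \<times>\<times> K)" "g \<in> carrier (G \<times>\<times> K)" for s t g
    using that translation_invariantD(2)[OF a] translation_invariantD(2)[OF b]
    by (cases s; cases t; cases g) (simp add: tensor_def)
  show "s \<otimes>\<^bsub>G \<times>\<times> K\<^esub> inv\<^bsub>G \<times>\<times> K\<^esub> t \<in> N \<times> M"
    if "s \<in> carrier (G \<times>\<times> K)" "t \<in> carrier (G \<times>\<times> K)" "tensor a b s t \<noteq> 0" for s t
    using that translation_invariantD(3)[OF a, of "fst s" "fst t"]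
      translation_invariantD(3)[OF b, of "snd s" "snd t"]
    by (cases s; cases t) (simp add: tensor_def inv_DirProd[OF group_axioms K.group_axioms])
qed

lemma tensor_in:
  "a \<in> cstar G \<Longrightarrow> b \<in> cstar K \<Longrightarrow> tensor a b \<in> cstar (G \<times>\<times> K)"
  using tensor_translation_invariant[of a "carrier G" b "carrier K"]
  unfolding cstar_eq K.cstar_eq finite_group.cstar_eq[OF finite_group_prod] by simp

text \<open>
  Immediate from \<open>\<lambda>(g) \<otimes> \<lambda>(h) = \<lambda>(g, h)\<close>. With it all facts about the algebra of a group apply to
  tensor powers.
\<close>

lemma tensor_alg_cstar: "tensor_alg (cstar G) (cstar K) = cstar (G \<times>\<times> K)"
proof -
  interpret GK: finite_group "G \<times>\<times> K" by (rule finite_group_prod)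
  show ?thesis
  proof
    show "tensor_alg (cstar G) (cstar K) \<subseteq> cstar (G \<times>\<times> K)"
    proof
      fix X assume "X \<in> tensor_alg (cstar G) (cstar K)"
      then obtain ps where ps: "set ps \<subseteq> cstar G \<times> cstar K"
        "X = (\<lambda>p q. \<Sum>(a, b)\<leftarrow>ps. tensor a b p q)"
        by (auto simp: tensor_alg_def)
      have "(\<lambda>p q. \<Sum>i\<leftarrow>ps. (case i of (a, b) \<Rightarrow> tensor a b) p q)
          \<in> translation_invariant (G \<times>\<times> K) (carrier G \<times> carrier K)"
        using ps(1) tensor_translation_invariant
        by (intro translation_invariant_sum_list) (auto simp: cstar_eq K.cstar_eq)
      then show "X \<in> cstar (G \<times>\<times> K)"
        unfolding GK.cstar_eq by (simp add: ps(2) split_def)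
    qed
    show "cstar (G \<times>\<times> K) \<subseteq> tensor_alg (cstar G) (cstar K)"
    proof
      fix X assume X: "X \<in> cstar (G \<times>\<times> K)"
      obtain ks where ks: "set ks = carrier (G \<times>\<times> K)" "distinct ks"
        using finite_distinct_list[OF GK.finite_carrier] by blast
      define ps where
        "ps = map (\<lambda>(g, h). (op_scale (X (g, h) \<one>\<^bsub>G \<times>\<times> K\<^esub>) (lreg G g), lreg K h)) ks"
      have "set ps \<subseteq> cstar G \<times> cstar K"
        using ks(1) by (auto simp: ps_def lreg_in_cstar K.lreg_in_cstar
            fd_cstar_algebraD(6)[OF fd_cstar_cstar])
      moreover have "X = (\<lambda>p q. \<Sum>(a, b)\<leftarrow>ps. tensor a b p q)"
      proof -
        have lreg_GK: "lreg (G \<times>\<times> K) c p q = lreg G (fst c) (fst p) (fst q) * lreg K (snd c) (snd p) (snd q)"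
          for c p q
          using tensor_lreg[of G "fst c" K "snd c"] by (simp add: tensor_def fun_eq_iff)
        have "X = lin_ext (G \<times>\<times> K) (lreg (G \<times>\<times> K)) X"
          using X unfolding GK.cstar_eq by (rule GK.lin_ext_lreg_self[symmetric])
        also have "\<dots> = (\<lambda>p q. \<Sum>(a, b)\<leftarrow>ps. tensor a b p q)"
          unfolding lin_ext_def ks(1)[symmetric] sum.distinct_set_conv_list[OF ks(2)]
          by (simp add: ps_def comp_def split_def tensor_def op_scale_def mult.assoc lreg_GK
              del: one_DirProd)
        finally show ?thesis .
      qed
      ultimately show "X \<in> tensor_alg (cstar G) (cstar K)"
        unfolding tensor_alg_def by blast
    qed
  qed
qed

text \<open>
  For a bilinear \<open>T\<close>, expanding both factors of \<open>a \<otimes> b\<close> shows that \<open>T a b\<close> is the value at \<open>a \<otimes> b\<close> of the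
  linear extension of \<open>(g, h) \<mapsto> T (\<lambda>(g)) (\<lambda>(h))\<close>. Hence every decomposition of \<open>X\<close> into elementary
  tensors leads to the same value, and the definite description denotes that value.
\<close>

lemma tensor_lift_eq_lin_ext:
  assumes X: "X \<in> cstar (G \<times>\<times> K)"
    and T1: "\<And>b. b \<in> cstar K \<Longrightarrow> linear_on (cstar G) (\<lambda>a. T a b)"
    and T2: "\<And>a. a \<in> cstar G \<Longrightarrow> linear_on (cstar K) (T a)"
  shows "tensor_lift (cstar G) (cstar K) T X = lin_ext (G \<times>\<times> K) (\<lambda>(g, h). T (lreg G g) (lreg K h)) X"
proof -
  let ?L = "lin_ext (G \<times>\<times> K) (\<lambda>(g, h). T (lreg G g) (lreg K h))"
  have simple: "T a b = ?L (tensor a b)" if a: "a \<in> cstar G" and b: "b \<in> cstar K" for a b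
  proof (intro ext)
    fix p q
    have "T a b p q = (\<Sum>g\<in>carrier G. a g \<one> * T (lreg G g) b p q)"
      by (subst linear_on_cstar_eq_lin_ext[OF T1[OF b] a]) (simp add: lin_ext_def)
    also have "\<dots> = (\<Sum>g\<in>carrier G. \<Sum>h\<in>carrier K. a g \<one> * (b h \<one>\<^bsub>K\<^esub> * T (lreg G g) (lreg K h) p q))"
    proof (rule sum.cong[OF refl])
      fix g assume "g \<in> carrier G"
      then have "T (lreg G g) b = lin_ext K (\<lambda>h. T (lreg G g) (lreg K h)) b"
        by (intro K.linear_on_cstar_eq_lin_ext T2 b lreg_in_cstar)
      then show "a g \<one> * T (lreg G g) b p q
          = (\<Sum>h\<in>carrier K. a g \<one> * (b h \<one>\<^bsub>K\<^esub> * T (lreg G g) (lreg K h) p q))"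
        by (simp add: lin_ext_def sum_distrib_left)
    qed
    finally show "T a b p q = ?L (tensor a b) p q"
      by (simp add: lin_ext_def sum.cartesian_product tensor_def case_prod_beta mult.assoc)
  qed
  have list: "(\<lambda>p q. \<Sum>(a, b)\<leftarrow>ps. T a b p q) = ?L (\<lambda>p q. \<Sum>(a, b)\<leftarrow>ps. tensor a b p q)"
    if "set ps \<subseteq> cstar G \<times> cstar K" for ps
    using that
  proof (induction ps)
    case Nil
    show ?case by (simp add: lin_ext_def)
  next
    case (Cons c ps)
    obtain a b where c: "c = (a, b)" by (cases c)
    have "(\<lambda>p q. \<Sum>(a, b)\<leftarrow>c # ps. T a b p q) = op_add (T a b) (\<lambda>p q. \<Sum>(a, b)\<leftarrow>ps. T a b p q)"
      by (simp add: c op_add_def)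
    also have "\<dots> = ?L (op_add (tensor a b) (\<lambda>p q. \<Sum>(a, b)\<leftarrow>ps. tensor a b p q))"
      using Cons c simple[of a b] by (simp add: lin_ext_add)
    finally show ?case
      by (simp add: c op_add_def)
  qed
  have "X \<in> tensor_alg (cstar G) (cstar K)"
    using X by (simp add: tensor_alg_cstar)
  then obtain ps where ps: "set ps \<subseteq> cstar G \<times> cstar K" "X = (\<lambda>p q. \<Sum>(a, b)\<leftarrow>ps. tensor a b p q)"
    by (auto simp: tensor_alg_def)
  show ?thesis
    unfolding tensor_lift_def
  proof (rule the_equality)
    show "\<exists>ps. set ps \<subseteq> cstar G \<times> cstar K \<and> X = (\<lambda>p q. \<Sum>(a, b)\<leftarrow>ps. tensor a b p q) \<and>
        ?L X = (\<lambda>p q. \<Sum>(a, b)\<leftarrow>ps. T a b p q)"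
      using ps list[OF ps(1)] by auto
    show "Y = ?L X" if "\<exists>ps. set ps \<subseteq> cstar G \<times> cstar K \<and>
        X = (\<lambda>p q. \<Sum>(a, b)\<leftarrow>ps. tensor a b p q) \<and> Y = (\<lambda>p q. \<Sum>(a, b)\<leftarrow>ps. T a b p q)" for Y
      using that list by auto
  qed
qed

lemma tensor_map_eq_lin_ext:
  assumes X: "X \<in> cstar (G \<times>\<times> K)" and f: "linear_on (cstar G) f" and k: "linear_on (cstar K) k"
  shows "tensor_map (cstar G) (cstar K) f k X
    = lin_ext (G \<times>\<times> K) (\<lambda>(g, h). tensor (f (lreg G g)) (k (lreg K h))) X"
  using X linear_on_tensor_left[OF f] linear_on_tensor_right[OF k] by (rule tensor_lift_eq_lin_ext)

end


section \<open>Structure maps of the group algebra\<close>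

lemma coprod_eq_group_map: "coprod G = group_map G (G \<times>\<times> G) (\<lambda>g. (g, g))"
  unfolding coprod_def group_map_def tensor_lreg ..

lemma aut_ext_eq_group_map: "aut_ext G \<alpha> = group_map G G \<alpha>"
  unfolding aut_ext_def group_map_def ..

lemma antipode_eq_group_map: "antipode G = group_map G G (\<lambda>g. inv\<^bsub>G\<^esub> g)"
  unfolding antipode_def group_map_def ..

lemma diagonal_hom: "(\<lambda>g. (g, g)) \<in> hom G (G \<times>\<times> G)"
  by (auto simp: hom_def)

text \<open>
  A scalar is viewed as an operator on a one-point space, so that the facts about linear
  extensions also serve the counit.
\<close>

lemma counit_eq_lin_ext: "counit G x = lin_ext G (\<lambda>g _ _. 1) x () ()"
  by (simp add: counit_def lin_ext_def)

lemma linear_on_group_map: "linear_on A (group_map G K \<phi>)"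
  unfolding group_map_def by (rule linear_on_lin_ext)

lemma linear_on_counit_left: "linear_on A (\<lambda>x. op_scale (counit G x) b)"
  by (simp add: linear_on_def counit_def op_add_def op_scale_def sum.distrib algebra_simps
      sum_distrib_left)

lemma linear_on_op_scale: "linear_on A (op_scale c)"
  by (simp add: linear_on_def op_add_def op_scale_def algebra_simps)

sublocale finite_group \<subseteq> square: finite_group_pair G G ..

context finite_group
begin

lemma group_map_lreg: "g \<in> carrier G \<Longrightarrow> group_map G K \<phi> (lreg G g) = lreg K (\<phi> g)"
  unfolding group_map_def by (rule lin_ext_lreg)

lemma counit_lreg: "g \<in> carrier G \<Longrightarrow> counit G (lreg G g) = 1"
  by (simp add: counit_eq_lin_ext lin_ext_lreg)

lemma counit_mult:
  assumes "x \<in> cstar G" "y \<in> cstar G"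
  shows "counit G (x \<star>\<^bsub>carrier G\<^esub> y) = counit G x * counit G y"
proof -
  let ?e = "lin_ext G (\<lambda>g (_ :: unit) (_ :: unit). 1)"
  have "?e x \<star>\<^bsub>{()}\<^esub> ?e y = ?e (x \<star>\<^bsub>carrier G\<^esub> y)"
    using assms by (intro lin_ext_mult[OF subgroup_self]) (auto simp: cstar_eq op_mult_def)
  then have "(?e x \<star>\<^bsub>{()}\<^esub> ?e y) () () = ?e (x \<star>\<^bsub>carrier G\<^esub> y) () ()"
    by simp
  then show ?thesis
    by (simp add: counit_eq_lin_ext op_mult_def)
qed

lemma counit_group_map:
  assumes "x \<in> cstar G" "\<And>g. g \<in> carrier G \<Longrightarrow> \<phi> g \<in> carrier G"
  shows "counit G (group_map G G \<phi> x) = counit G x"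
  unfolding counit_eq_lin_ext by (subst square.lin_ext_group_map[OF assms]) simp_all

text \<open>
  The transpose of \<open>\<lambda>(g)\<close> is \<open>\<lambda>(g\<^sup>-\<^sup>1)\<close>. In this form it is evident that the antipode reverses
  products and commutes with the adjoint.
\<close>

lemma antipode_eq_transpose:
  assumes x: "x \<in> cstar G"
  shows "antipode G x = (\<lambda>s t. x t s)"
proof (intro ext)
  fix s t
  show "antipode G x s t = x t s"
  proof (cases "s \<in> carrier G \<and> t \<in> carrier G")
    case True
    have eq: "s = inv g \<otimes> t \<longleftrightarrow> g = t \<otimes> inv s" if "g \<in> carrier G" for g
      using True that by (metis inv_closed inv_solve_left inv_solve_right)
    have "antipode G x s t = (\<Sum>g\<in>carrier G. if g = t \<otimes> inv s then x g \<one> else 0)"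
      unfolding antipode_def lin_ext_def lreg_def using True
      by (intro sum.cong) (auto simp: eq)
    also have "\<dots> = x t s"
      using True x finite_carrier translation_invariant_entry by (simp add: sum.delta cstar_eq)
    finally show ?thesis .
  next
    case False
    then show ?thesis
      using x translation_invariantD(1)[of x G]
      by (auto simp: opers_def antipode_def lin_ext_def lreg_def cstar_eq)
  qed
qed

lemma antipode_in: "x \<in> cstar G \<Longrightarrow> antipode G x \<in> cstar G"
  unfolding antipode_eq_group_map cstar_eq by (rule square.group_map_in[OF _ subgroup_self]) auto

lemma antipode_mult:
  assumes "x \<in> cstar G" "y \<in> cstar G"
  shows "antipode G (x \<star>\<^bsub>carrier G\<^esub> y) = antipode G y \<star>\<^bsub>carrier G\<^esub> antipode G x"
  unfolding antipode_eq_transpose[OF fd_cstar_algebraD(5)[OF fd_cstar_cstar assms]]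
    antipode_eq_transpose[OF assms(1)] antipode_eq_transpose[OF assms(2)]
  by (simp add: op_mult_def mult.commute)

lemma antipode_adj: "x \<in> cstar G \<Longrightarrow> antipode G (adj x) = adj (antipode G x)"
  by (simp only: antipode_eq_transpose fd_cstar_algebraD(7)[OF fd_cstar_cstar]) (simp add: adj_def)

lemma aut_ext_antipode:
  assumes \<alpha>: "\<alpha> \<in> hom G G" and x: "x \<in> cstar G"
  shows "aut_ext G \<alpha> (antipode G x) = antipode G (aut_ext G \<alpha> x)"
proof -
  interpret hom: group_hom G G \<alpha>
    by unfold_locales (rule \<alpha>)
  have "group_map G G (\<lambda>g. \<alpha> (inv g)) x = group_map G G (\<lambda>g. inv (\<alpha> g)) x"
    unfolding group_map_def using x by (intro lin_ext_cong_cstar) auto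
  then show ?thesis
    using x by (simp add: aut_ext_eq_group_map antipode_eq_group_map square.group_map_comp)
qed

end


section \<open>Lifted cocycles\<close>

text \<open>
  The projections lie in the algebra of \<open>H\<close>, so \<open>\<Omega>\<close> lies in that of \<open>H \<times> H\<close>. Through this support
  condition the commutativity of \<open>H\<close> acts on \<open>\<Omega>\<close>.
\<close>

lemma (in finite_group) lifted_translation_invariant:
  assumes H: "subgroup H G" and "lifted_from G H \<Omega>"
  shows "\<Omega> \<in> translation_invariant (G \<times>\<times> G) (H \<times> H)"
proof -
  from assms(2) obtain P \<omega> where P: "spectral_projections G H P"
    and \<Omega>: "\<Omega> = (\<lambda>p q. \<Sum>x\<in>dual_group G H. \<Sum>y\<in>dual_group G H. \<omega> x y * tensor (P x) (P y) p q)"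
    unfolding lifted_from_def by blast
  have Px: "P x \<in> translation_invariant G H" if "x \<in> dual_group G H" for x
    using P that by (simp add: spectral_projections_def cstar_sub_eq[OF H])
  have "(\<lambda>p q. \<Sum>x\<in>dual_group G H. 1 * (\<Sum>y\<in>dual_group G H. \<omega> x y * tensor (P x) (P y) p q))
      \<in> translation_invariant (G \<times>\<times> G) (H \<times> H)"
    by (intro translation_invariant_sum square.tensor_translation_invariant Px)
  then show ?thesis
    by (simp add: \<Omega>)
qed

lemma assoc_lreg:
  "assoc (lreg ((G \<times>\<times> K) \<times>\<times> L) (p, k)) = lreg (G \<times>\<times> K \<times>\<times> L) (fst p, snd p, k)"
proof (intro ext)
  fix s t
  show "assoc (lreg ((G \<times>\<times> K) \<times>\<times> L) (p, k)) s t = lreg (G \<times>\<times> K \<times>\<times> L) (fst p, snd p, k) s t"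
    by (cases p; cases s rule: prod_cases3; cases t rule: prod_cases3)
      (auto simp: assoc_def lreg_def)
qed

lemma assoc_lin_ext: "assoc (lin_ext G T X) = lin_ext G (\<lambda>g. assoc (T g)) X"
  by (simp add: assoc_def lin_ext_def split_def)

context finite_group
begin

lemma tensor_one_eq_group_map:
  assumes "X \<in> cstar (G \<times>\<times> G)"
  shows "tensor_one G X = group_map (G \<times>\<times> G) (G \<times>\<times> G \<times>\<times> G) (\<lambda>(g, h). (g, h, \<one>)) X"
proof -
  interpret GG: finite_group "G \<times>\<times> G" by (rule square.finite_group_prod)
  have "linear_on (cstar (G \<times>\<times> G)) (\<lambda>X. assoc (tensor X (lreg G \<one>)))"
    using linear_on_assoc[OF linear_on_tensor_left[OF linear_on_id]] by simp
  from GG.linear_on_cstar_eq_lin_ext[OF this assms] show ?thesis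
    unfolding group_map_def lreg_one[symmetric] by (simp add: tensor_lreg assoc_lreg split_def)
qed

lemma one_tensor_eq_group_map:
  assumes "X \<in> cstar (G \<times>\<times> G)"
  shows "one_tensor G X = group_map (G \<times>\<times> G) (G \<times>\<times> G \<times>\<times> G) (\<lambda>(g, h). (\<one>, g, h)) X"
proof -
  interpret GG: finite_group "G \<times>\<times> G" by (rule square.finite_group_prod)
  have "linear_on (cstar (G \<times>\<times> G)) (\<lambda>X. tensor (lreg G \<one>) X)"
    using linear_on_tensor_right[OF linear_on_id] by simp
  from GG.linear_on_cstar_eq_lin_ext[OF this assms] show ?thesis
    unfolding group_map_def lreg_one[symmetric] by (simp add: tensor_lreg split_def)
qed

lemma coprod_left_eq_group_map:
  assumes X: "X \<in> cstar (G \<times>\<times> G)"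
  shows "coprod_left G X = group_map (G \<times>\<times> G) (G \<times>\<times> G \<times>\<times> G) (\<lambda>(g, h). (g, g, h)) X"
proof -
  interpret GG: finite_group "G \<times>\<times> G" by (rule square.finite_group_prod)
  have "coprod_left G X = lin_ext (G \<times>\<times> G) (\<lambda>(g, h). assoc (tensor (coprod G (lreg G g)) (lreg G h))) X"
    unfolding coprod_left_def coprod_eq_group_map
    by (subst square.tensor_map_eq_lin_ext[OF X linear_on_group_map linear_on_id])
      (simp add: assoc_lin_ext split_def)
  also have "\<dots> = group_map (G \<times>\<times> G) (G \<times>\<times> G \<times>\<times> G) (\<lambda>(g, h). (g, g, h)) X"
    unfolding group_map_def using X
    by (intro GG.lin_ext_cong_cstar)
      (auto simp: coprod_eq_group_map group_map_lreg tensor_lreg assoc_lreg)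
  finally show ?thesis .
qed

lemma coprod_right_eq_group_map:
  assumes X: "X \<in> cstar (G \<times>\<times> G)"
  shows "coprod_right G X = group_map (G \<times>\<times> G) (G \<times>\<times> G \<times>\<times> G) (\<lambda>(g, h). (g, h, h)) X"
proof -
  interpret GG: finite_group "G \<times>\<times> G" by (rule square.finite_group_prod)
  have "coprod_right G X = lin_ext (G \<times>\<times> G) (\<lambda>(g, h). tensor (lreg G g) (coprod G (lreg G h))) X"
    unfolding coprod_right_def coprod_eq_group_map
    by (subst square.tensor_map_eq_lin_ext[OF X linear_on_id linear_on_group_map]) simp
  also have "\<dots> = group_map (G \<times>\<times> G) (G \<times>\<times> G \<times>\<times> G) (\<lambda>(g, h). (g, h, h)) X"
    unfolding group_map_def using X
    by (intro GG.lin_ext_cong_cstar)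
      (auto simp: coprod_eq_group_map group_map_lreg tensor_lreg)
  finally show ?thesis .
qed

lemma slice_left_counit:
  assumes X: "X \<in> cstar (G \<times>\<times> G)"
  shows "slice_left (cstar G) (counit G) X = lin_ext (G \<times>\<times> G) (\<lambda>(g, h). lreg G h) X"
proof -
  interpret GG: finite_group "G \<times>\<times> G" by (rule square.finite_group_prod)
  have "slice_left (cstar G) (counit G) X
      = lin_ext (G \<times>\<times> G) (\<lambda>(g, h). op_scale (counit G (lreg G g)) (lreg G h)) X"
    by (intro square.tensor_lift_eq_lin_ext X linear_on_counit_left linear_on_op_scale)
  also have "\<dots> = lin_ext (G \<times>\<times> G) (\<lambda>(g, h). lreg G h) X"
    using X by (intro GG.lin_ext_cong_cstar) (auto simp: counit_lreg op_scale_def)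
  finally show ?thesis .
qed

lemma slice_right_counit:
  assumes X: "X \<in> cstar (G \<times>\<times> G)"
  shows "slice_right (cstar G) (counit G) X = lin_ext (G \<times>\<times> G) (\<lambda>(g, h). lreg G g) X"
proof -
  interpret GG: finite_group "G \<times>\<times> G" by (rule square.finite_group_prod)
  have "slice_right (cstar G) (counit G) X
      = lin_ext (G \<times>\<times> G) (\<lambda>(g, h). op_scale (counit G (lreg G h)) (lreg G g)) X"
    by (intro square.tensor_lift_eq_lin_ext X linear_on_counit_left linear_on_op_scale)
  also have "\<dots> = lin_ext (G \<times>\<times> G) (\<lambda>(g, h). lreg G g) X"
    using X by (intro GG.lin_ext_cong_cstar) (auto simp: counit_lreg op_scale_def)
  finally show ?thesis .
qed

lemma lifted_unitary_eq_lin_ext: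
  assumes X: "X \<in> cstar (G \<times>\<times> G)"
  shows "lifted_unitary G X = lin_ext (G \<times>\<times> G) (\<lambda>(g, h). lreg G (g \<otimes> inv h)) X"
proof -
  interpret GG: finite_group "G \<times>\<times> G" by (rule square.finite_group_prod)
  let ?\<phi> = "\<lambda>(g, h). (g, inv h)"
  have \<phi>: "?\<phi> p \<in> carrier (G \<times>\<times> G)" if "p \<in> carrier (G \<times>\<times> G)" for p
    using that by auto
  have "tensor_map (cstar G) (cstar G) id (antipode G) X
      = lin_ext (G \<times>\<times> G) (\<lambda>(g, h). tensor (lreg G g) (antipode G (lreg G h))) X"
    unfolding antipode_eq_group_map
    by (subst square.tensor_map_eq_lin_ext[OF X linear_on_id linear_on_group_map]) simp
  also have "\<dots> = group_map (G \<times>\<times> G) (G \<times>\<times> G) ?\<phi> X"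
    unfolding group_map_def using X
    by (intro GG.lin_ext_cong_cstar)
      (auto simp: antipode_eq_group_map group_map_lreg tensor_lreg)
  finally have step: "tensor_map (cstar G) (cstar G) id (antipode G) X
      = group_map (G \<times>\<times> G) (G \<times>\<times> G) ?\<phi> X" .
  have in_GG: "group_map (G \<times>\<times> G) (G \<times>\<times> G) ?\<phi> X \<in> cstar (G \<times>\<times> G)"
    using X \<phi> unfolding GG.cstar_eq by (rule GG.square.group_map_in[OF _ GG.subgroup_self])
  have "lifted_unitary G X = lin_ext (G \<times>\<times> G) (\<lambda>(g, h). lreg G g \<star>\<^bsub>carrier G\<^esub> lreg G h)
      (group_map (G \<times>\<times> G) (G \<times>\<times> G) ?\<phi> X)"
    unfolding lifted_unitary_def step
    using linear_on_op_mult_left[OF linear_on_id] linear_on_op_mult_right[OF linear_on_id]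
    by (intro square.tensor_lift_eq_lin_ext in_GG) simp_all
  also have "\<dots> = lin_ext (G \<times>\<times> G) (\<lambda>p. case ?\<phi> p of (g, h) \<Rightarrow> lreg G g \<star>\<^bsub>carrier G\<^esub> lreg G h) X"
    by (rule GG.square.lin_ext_group_map[OF X \<phi>])
  also have "\<dots> = lin_ext (G \<times>\<times> G) (\<lambda>(g, h). lreg G (g \<otimes> inv h)) X"
    using X by (intro GG.lin_ext_cong_cstar) (auto simp: lreg_mult)
  finally show ?thesis .
qed

text \<open>
  In terms of a function \<open>\<omega>\<close> on the dual group this says that a normalised cocycle satisfies
  \<open>\<omega>(x, x\<^sup>-\<^sup>1) = \<omega>(x\<^sup>-\<^sup>1, x)\<close>, which is the cocycle identity at \<open>(x, x\<^sup>-\<^sup>1, x)\<close>. Restricting to such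
  triples is dual to the map \<open>\<Phi>\<close> induced by \<open>(a, b, c) \<mapsto> a b\<^sup>-\<^sup>1 c\<close>.
\<close>

lemma antipode_lifted_unitary:
  assumes H: "subgroup H G" and comm: "comm_group (G\<lparr>carrier := H\<rparr>)"
    and lifted: "lifted_from G H \<Omega>" and coc: "two_cocycle G \<Omega>" and cou: "counital G \<Omega>"
  shows "antipode G (lifted_unitary G \<Omega>) = lifted_unitary G \<Omega>"
proof -
  interpret GG: finite_group "G \<times>\<times> G" by (rule square.finite_group_prod)
  interpret P: finite_group_pair "G \<times>\<times> G" G ..
  interpret Q: finite_group_pair G "G \<times>\<times> G" ..
  interpret GGG: finite_group "G \<times>\<times> G \<times>\<times> G" by (rule Q.finite_group_prod)
  interpret R: finite_group_pair "G \<times>\<times> G" "G \<times>\<times> G \<times>\<times> G" ..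
  interpret H: subgroup H G by (rule H)
  have HHH: "subgroup (H \<times> H \<times> H) (G \<times>\<times> G \<times>\<times> G)"
    by (intro DirProd_subgroups group_axioms GG.group_axioms H)
  have c: "x \<otimes> y = y \<otimes> x" if "x \<in> H" "y \<in> H" for x y
    using comm_monoid.m_comm[OF comm_group.axioms(1)[OF comm], of x y] that by simp
  have lc: "x \<otimes> (y \<otimes> z) = y \<otimes> (x \<otimes> z)" if "x \<in> H" "y \<in> H" "z \<in> H" for x y z
    using c[OF that(1,2)] that by (simp add: m_assoc[symmetric])
  have \<Omega>H: "\<Omega> \<in> translation_invariant (G \<times>\<times> G) (H \<times> H)"
    by (rule lifted_translation_invariant[OF H lifted])
  have \<Omega>: "\<Omega> \<in> cstar (G \<times>\<times> G)"
    using coc by (simp add: two_cocycle_def unitary_in_def square.tensor_alg_cstar)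
  let ?u = "lifted_unitary G \<Omega>"
  let ?t = "\<lambda>(a, b, c). lreg G (a \<otimes> inv b \<otimes> c)"
  let ?\<Phi> = "lin_ext (G \<times>\<times> G \<times>\<times> G) ?t"
  have \<Phi>_group_map: "?\<Phi> (group_map (G \<times>\<times> G) (G \<times>\<times> G \<times>\<times> G) \<phi> \<Omega>)
      = lin_ext (G \<times>\<times> G) (\<lambda>p. ?t (\<phi> p)) \<Omega>"
    if "\<And>p. p \<in> carrier (G \<times>\<times> G) \<Longrightarrow> \<phi> p \<in> carrier (G \<times>\<times> G \<times>\<times> G)" for \<phi>
    using \<Omega> that by (rule R.lin_ext_group_map)
  have \<Phi>_mult: "?\<Phi> X \<star>\<^bsub>carrier G\<^esub> ?\<Phi> Y = ?\<Phi> (X \<star>\<^bsub>carrier3 G\<^esub> Y)"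
    if "X \<in> translation_invariant (G \<times>\<times> G \<times>\<times> G) (H \<times> H \<times> H)"
      "Y \<in> translation_invariant (G \<times>\<times> G \<times>\<times> G) (H \<times> H \<times> H)" for X Y
  proof -
    have "?\<Phi> X \<star>\<^bsub>carrier G\<^esub> ?\<Phi> Y = ?\<Phi> (X \<star>\<^bsub>carrier (G \<times>\<times> G \<times>\<times> G)\<^esub> Y)"
      using HHH that
    proof (rule GGG.lin_ext_mult)
      fix p q assume "p \<in> H \<times> H \<times> H" "q \<in> H \<times> H \<times> H"
      then show "?t p \<star>\<^bsub>carrier G\<^esub> ?t q = ?t (p \<otimes>\<^bsub>G \<times>\<times> G \<times>\<times> G\<^esub> q)"
        by (auto simp: lreg_mult inv_mult_group m_assoc c lc)
    qed
    then show ?thesis by simp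
  qed
  have in_H: "group_map (G \<times>\<times> G) (G \<times>\<times> G \<times>\<times> G) \<phi> \<Omega>
      \<in> translation_invariant (G \<times>\<times> G \<times>\<times> G) (H \<times> H \<times> H)"
    if "\<And>p. p \<in> H \<times> H \<Longrightarrow> \<phi> p \<in> H \<times> H \<times> H" for \<phi>
    using \<Omega>H HHH that by (rule R.group_map_in)
  \<comment> \<open>The four images under \<open>\<Phi>\<close> are read off from \<open>(g, h) \<mapsto> (g, h, 1), (g, g, h), (1, g, h), (g, h, h)\<close>.\<close>
  have \<Phi>1: "?\<Phi> (tensor_one G \<Omega>) = ?u"
    unfolding tensor_one_eq_group_map[OF \<Omega>] lifted_unitary_eq_lin_ext[OF \<Omega>]
    by (subst \<Phi>_group_map, force) (rule GG.lin_ext_cong[OF \<Omega>H], auto)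
  have \<Phi>2: "?\<Phi> (coprod_left G \<Omega>) = op_one (carrier G)"
  proof -
    have "?\<Phi> (coprod_left G \<Omega>) = lin_ext (G \<times>\<times> G) (\<lambda>(g, h). lreg G h) \<Omega>"
      unfolding coprod_left_eq_group_map[OF \<Omega>]
      by (subst \<Phi>_group_map, force) (rule GG.lin_ext_cong[OF \<Omega>H], auto)
    then show ?thesis
      using cou by (simp add: counital_def slice_left_counit[OF \<Omega>])
  qed
  have \<Phi>3: "?\<Phi> (one_tensor G \<Omega>) = antipode G ?u"
  proof -
    have "?\<Phi> (one_tensor G \<Omega>) = lin_ext (G \<times>\<times> G) (\<lambda>(g, h). lreg G (inv g \<otimes> h)) \<Omega>"
      unfolding one_tensor_eq_group_map[OF \<Omega>]
      by (subst \<Phi>_group_map, force) (rule GG.lin_ext_cong[OF \<Omega>H], auto)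
    \<comment> \<open>Commutativity of \<open>H\<close>: \<open>g\<^sup>-\<^sup>1 h = (g h\<^sup>-\<^sup>1)\<^sup>-\<^sup>1\<close>.\<close>
    also have "\<dots> = lin_ext (G \<times>\<times> G) (\<lambda>p. lreg G (inv (case p of (g, h) \<Rightarrow> g \<otimes> inv h))) \<Omega>"
      by (rule GG.lin_ext_cong[OF \<Omega>H]) (auto simp: inv_mult_group c)
    also have "\<dots> = antipode G (group_map (G \<times>\<times> G) G (\<lambda>(g, h). g \<otimes> inv h) \<Omega>)"
      unfolding antipode_def by (rule P.lin_ext_group_map[OF \<Omega>, symmetric]) auto
    finally show ?thesis
      by (simp add: lifted_unitary_eq_lin_ext[OF \<Omega>] group_map_def split_def)
  qed
  have \<Phi>4: "?\<Phi> (coprod_right G \<Omega>) = op_one (carrier G)"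
  proof -
    have "?\<Phi> (coprod_right G \<Omega>) = lin_ext (G \<times>\<times> G) (\<lambda>(g, h). lreg G g) \<Omega>"
      unfolding coprod_right_eq_group_map[OF \<Omega>]
      by (subst \<Phi>_group_map, force) (rule GG.lin_ext_cong[OF \<Omega>H], auto simp: m_assoc)
    then show ?thesis
      using cou by (simp add: counital_def slice_right_counit[OF \<Omega>])
  qed
  have "?\<Phi> (tensor_one G \<Omega>) \<star>\<^bsub>carrier G\<^esub> ?\<Phi> (coprod_left G \<Omega>)
      = ?\<Phi> (tensor_one G \<Omega> \<star>\<^bsub>carrier3 G\<^esub> coprod_left G \<Omega>)"
    unfolding tensor_one_eq_group_map[OF \<Omega>] coprod_left_eq_group_map[OF \<Omega>]
    by (intro \<Phi>_mult in_H) auto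
  also have "\<dots> = ?\<Phi> (one_tensor G \<Omega> \<star>\<^bsub>carrier3 G\<^esub> coprod_right G \<Omega>)"
    using coc by (simp add: two_cocycle_def)
  also have "\<dots> = ?\<Phi> (one_tensor G \<Omega>) \<star>\<^bsub>carrier G\<^esub> ?\<Phi> (coprod_right G \<Omega>)"
    unfolding one_tensor_eq_group_map[OF \<Omega>] coprod_right_eq_group_map[OF \<Omega>]
    by (intro \<Phi>_mult[symmetric] in_H) auto
  finally have "?u \<star>\<^bsub>carrier G\<^esub> op_one (carrier G) = antipode G ?u \<star>\<^bsub>carrier G\<^esub> op_one (carrier G)"
    unfolding \<Phi>1 \<Phi>2 \<Phi>3 \<Phi>4 .
  moreover have "?u \<in> opers (carrier G)" "antipode G ?u \<in> opers (carrier G)"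
  proof -
    have "?u = group_map (G \<times>\<times> G) G (\<lambda>(g, h). g \<otimes> inv h) \<Omega>"
      by (simp add: lifted_unitary_eq_lin_ext[OF \<Omega>] group_map_def split_def)
    also have "\<dots> \<in> cstar G"
      using \<Omega> unfolding cstar_eq GG.cstar_eq by (rule P.group_map_in[OF _ subgroup_self]) auto
    finally have "?u \<in> cstar G" .
    then show "?u \<in> opers (carrier G)" "antipode G ?u \<in> opers (carrier G)"
      using antipode_in fd_cstar_algebraD(2)[OF fd_cstar_cstar] by blast+
  qed
  ultimately show ?thesis
    by (simp add: op_mult_one_right[OF finite_carrier])
qed

end


section \<open>The twisted automorphism\<close>

context finite_group
begin

lemma aut_ext_inv2_eq_group_map:
  assumes X: "X \<in> cstar (G \<times>\<times> G)" and \<alpha>: "bij_betw \<alpha> (carrier G) (carrier G)"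
  shows "aut_ext_inv2 G \<alpha> X
    = group_map (G \<times>\<times> G) (G \<times>\<times> G) (map_prod (inv_into (carrier G) \<alpha>) (inv_into (carrier G) \<alpha>)) X"
proof -
  interpret GG: finite_group "G \<times>\<times> G" by (rule square.finite_group_prod)
  show ?thesis
    unfolding aut_ext_inv2_def Let_def aut_ext_eq_group_map group_map_def[of "G \<times>\<times> G"]
    using X bij_betwE[OF bij_betw_inv_into[OF \<alpha>]]
    by (subst square.tensor_map_eq_lin_ext[OF X linear_on_group_map linear_on_group_map],
        intro GG.lin_ext_cong_cstar) (auto simp: group_map_lreg tensor_lreg)
qed

text \<open>
  On elementary tensors of group elements both sides are \<open>\<gamma>(\<lambda>(g)) \<otimes> \<gamma>(\<lambda>(h))\<close>, and the right hand
  side is linear.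
\<close>

lemma tensor_map_conj_group_map:
  assumes X: "X \<in> cstar (G \<times>\<times> G)" and \<phi>: "\<And>g. g \<in> carrier G \<Longrightarrow> \<phi> g \<in> carrier G"
    and \<gamma>: "\<gamma> = (\<lambda>x. u \<star>\<^bsub>carrier G\<^esub> group_map G G \<phi> x \<star>\<^bsub>carrier G\<^esub> v)"
  shows "tensor_map (cstar G) (cstar G) \<gamma> \<gamma> X
    = tensor u u \<star>\<^bsub>carrier2 G\<^esub> group_map (G \<times>\<times> G) (G \<times>\<times> G) (map_prod \<phi> \<phi>) X \<star>\<^bsub>carrier2 G\<^esub> tensor v v"
proof -
  interpret GG: finite_group "G \<times>\<times> G" by (rule square.finite_group_prod)
  have lin: "linear_on A \<gamma>" for A
    unfolding \<gamma> by (intro linear_on_op_mult_right linear_on_op_mult_left linear_on_group_map)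
  let ?r = "\<lambda>X. tensor u u \<star>\<^bsub>carrier2 G\<^esub> group_map (G \<times>\<times> G) (G \<times>\<times> G) (map_prod \<phi> \<phi>) X \<star>\<^bsub>carrier2 G\<^esub> tensor v v"
  have "tensor_map (cstar G) (cstar G) \<gamma> \<gamma> X
      = lin_ext (G \<times>\<times> G) (\<lambda>(g, h). tensor (\<gamma> (lreg G g)) (\<gamma> (lreg G h))) X"
    by (rule square.tensor_map_eq_lin_ext[OF X lin lin])
  also have "\<dots> = lin_ext (G \<times>\<times> G) (\<lambda>p. ?r (lreg (G \<times>\<times> G) p)) X"
    using X by (intro GG.lin_ext_cong_cstar)
      (auto simp: \<gamma> group_map_lreg GG.group_map_lreg tensor_mult[symmetric] tensor_lreg)
  also have "\<dots> = ?r X"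
    by (intro GG.linear_on_cstar_eq_lin_ext[symmetric] X linear_on_op_mult_right
        linear_on_op_mult_left linear_on_group_map)
  finally show ?thesis .
qed

text \<open>
  Both sides are conjugates of \<open>\<Delta>(\<alpha>(x))\<close>, by the unitaries \<open>W = (u \<otimes> u) (\<alpha> \<otimes> \<alpha>)(\<Omega>)\<close> and
  \<open>Z = \<Omega> \<Delta>(u)\<close>. The element of the commutant must have \<open>\<Omega>\<^sup>*\<close> as its left factor: with \<open>C\<close> so formed,
  \<open>\<Omega> C = (\<alpha>\<^sup>-\<^sup>1 \<otimes> \<alpha>\<^sup>-\<^sup>1)(\<Omega>\<^sup>u)\<close>, whence \<open>Z = W (\<alpha> \<otimes> \<alpha>)(C)\<close> and the last factor stands next to
  \<open>\<Delta>(\<alpha>(x))\<close>.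
\<close>

lemma twisted_coprod_intertwined:
  assumes \<alpha>: "\<alpha> \<in> iso G G"
    and u: "unitary_in (carrier G) (cstar G) u"
    and \<Omega>: "unitary_in (carrier2 G) (cstar2 G) \<Omega>"
    and \<gamma>: "\<gamma> = (\<lambda>x. u \<star>\<^bsub>carrier G\<^esub> aut_ext G \<alpha> x \<star>\<^bsub>carrier G\<^esub> adj u)"
    and gauge: "adj \<Omega> \<star>\<^bsub>carrier2 G\<^esub> aut_ext_inv2 G \<alpha> (gauge G \<Omega> u) \<in> coprod_commutant G"
    and x: "x \<in> cstar G"
  shows "tensor_map (cstar G) (cstar G) \<gamma> \<gamma> (twisted_coprod G \<Omega> x) = twisted_coprod G \<Omega> (\<gamma> x)"
proof -
  interpret GG: finite_group "G \<times>\<times> G" by (rule square.finite_group_prod)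
  interpret P: finite_group_pair G "G \<times>\<times> G" ..
  let ?A = "cstar (G \<times>\<times> G)"
  let ?I = "carrier (G \<times>\<times> G)"
  let ?\<beta> = "inv_into (carrier G) \<alpha>"
  let ?a = "group_map (G \<times>\<times> G) (G \<times>\<times> G) (map_prod \<alpha> \<alpha>)"
  let ?b = "group_map (G \<times>\<times> G) (G \<times>\<times> G) (map_prod ?\<beta> ?\<beta>)"
  have I: "carrier2 G = ?I" and A: "cstar2 G = ?A"
    by (simp_all add: square.tensor_alg_cstar)
  have \<alpha>hom: "\<alpha> \<in> hom G G" and bij: "bij_betw \<alpha> (carrier G) (carrier G)"
    using \<alpha> by (auto simp: iso_def)
  have \<alpha>c: "\<alpha> g \<in> carrier G" "?\<beta> g \<in> carrier G" if "g \<in> carrier G" for g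
    using bij_betwE[OF bij] bij_betwE[OF bij_betw_inv_into[OF bij]] that by auto
  have \<beta>hom: "?\<beta> \<in> hom G G"
    using iso_set_sym[OF \<alpha>] by (auto simp: iso_def)
  have a_hom: "star_hom ?I ?A ?I ?A ?a"
    using \<alpha>hom by (intro GG.square.star_hom_group_map) (auto simp: hom_def)
  have b_hom: "star_hom ?I ?A ?I ?A ?b"
    using \<beta>hom by (intro GG.square.star_hom_group_map) (auto simp: hom_def)
  have D_hom: "star_hom (carrier G) (cstar G) ?I ?A (coprod G)"
    unfolding coprod_eq_group_map by (rule P.star_hom_group_map[OF diagonal_hom])
  have al_hom: "star_hom (carrier G) (cstar G) (carrier G) (cstar G) (aut_ext G \<alpha>)"
    unfolding aut_ext_eq_group_map by (rule square.star_hom_group_map[OF \<alpha>hom])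
  note fd = fd_cstar_algebraD[OF fd_cstar_cstar] and fd2 = fd_cstar_algebraD[OF GG.fd_cstar_cstar]
  note a = star_homD[OF a_hom] and D = star_homD[OF D_hom] and al = star_homD[OF al_hom]
  have ab: "?a (?b X) = X" if X: "X \<in> ?A" for X
  proof -
    have "?a (?b X) = group_map (G \<times>\<times> G) (G \<times>\<times> G) (\<lambda>p. map_prod \<alpha> \<alpha> (map_prod ?\<beta> ?\<beta> p)) X"
      using X by (rule GG.square.group_map_comp) (auto simp: \<alpha>c)
    also have "\<dots> = X"
      using X by (rule GG.group_map_id) (auto simp: bij_betw_inv_into_right[OF bij])
    finally show ?thesis .
  qed
  have aD: "?a (coprod G y) = coprod G (aut_ext G \<alpha> y)" if y: "y \<in> cstar G" for y
  proof -
    have "?a (coprod G y) = group_map G (G \<times>\<times> G) (\<lambda>g. map_prod \<alpha> \<alpha> (g, g)) y"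
      unfolding coprod_eq_group_map using y by (rule P.group_map_comp) simp
    also have "\<dots> = coprod G (aut_ext G \<alpha> y)"
      unfolding coprod_eq_group_map aut_ext_eq_group_map
      using square.group_map_comp[OF y \<alpha>c(1), where L = "G \<times>\<times> G" and \<psi> = "\<lambda>g. (g, g)"] by simp
    finally show ?thesis .
  qed
  let ?U = "tensor u u"
  have uA: "u \<in> cstar G" "adj u \<in> cstar G"
    using u by (auto simp: unitary_in_def fd)
  have U: "unitary_in ?I ?A ?U"
    using u uA by (simp add: unitary_in_def square.tensor_in[simplified] adj_tensor tensor_mult tensor_op_one)
  have \<Omega>u: "unitary_in ?I ?A \<Omega>"
    using \<Omega> unfolding I A .
  have Du: "unitary_in ?I ?A (coprod G u)"
    by (rule unitary_in_star_hom[OF D_hom fd_cstar_cstar u])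
  define Z where "Z = \<Omega> \<star>\<^bsub>?I\<^esub> coprod G u"
  define g where "g = adj ?U \<star>\<^bsub>?I\<^esub> Z"
  have Zu: "unitary_in ?I ?A Z"
    unfolding Z_def by (rule unitary_in_mult[OF GG.fd_cstar_cstar \<Omega>u Du])
  have gu: "unitary_in ?I ?A g"
    unfolding g_def
    by (rule unitary_in_mult[OF GG.fd_cstar_cstar unitary_in_adj[OF GG.fd_cstar_cstar U] Zu])
  have g_eq: "gauge G \<Omega> u = g"
    unfolding gauge_def g_def Z_def I adj_tensor op_mult_assoc ..
  define C where "C = adj \<Omega> \<star>\<^bsub>?I\<^esub> ?b g"
  have Cu: "unitary_in ?I ?A C"
    unfolding C_def
    by (rule unitary_in_mult[OF GG.fd_cstar_cstar unitary_in_adj[OF GG.fd_cstar_cstar \<Omega>u]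
          unitary_in_star_hom[OF b_hom GG.fd_cstar_cstar gu]])
  have C_comm: "C \<star>\<^bsub>?I\<^esub> coprod G x = coprod G x \<star>\<^bsub>?I\<^esub> C"
    using gauge x unitary_inD(1)[OF gu]
    unfolding coprod_commutant_def commutant_def g_eq C_def I
    by (simp add: aut_ext_inv2_eq_group_map[OF _ bij])
  let ?X = "coprod G (aut_ext G \<alpha> x)"
  have XA: "?X \<in> ?A"
    by (intro D(1) al(1) x)
  have c_comm: "?a C \<star>\<^bsub>?I\<^esub> ?X = ?X \<star>\<^bsub>?I\<^esub> ?a C"
    using arg_cong[OF C_comm, of ?a] unitary_inD(1)[OF Cu] D(1)[OF x] x by (simp only: a(4) aD)
  have cu: "unitary_in ?I ?A (?a C)"
    by (rule unitary_in_star_hom[OF a_hom GG.fd_cstar_cstar Cu])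
  define W where "W = ?U \<star>\<^bsub>?I\<^esub> ?a \<Omega>"
  have ZW: "Z = W \<star>\<^bsub>?I\<^esub> ?a C"
  proof -
    note mem = unitary_inD(1)[OF \<Omega>u] unitary_inD(1)[OF Cu] unitary_inD(1)[OF gu]
      unitary_inD(1)[OF unitary_in_star_hom[OF b_hom GG.fd_cstar_cstar gu]] unitary_inD(1)[OF Zu]
    have "\<Omega> \<star>\<^bsub>?I\<^esub> C = (\<Omega> \<star>\<^bsub>?I\<^esub> adj \<Omega>) \<star>\<^bsub>?I\<^esub> ?b g"
      by (simp only: C_def op_mult_assoc)
    also have "\<dots> = ?b g"
      unfolding unitary_inD(2)[OF \<Omega>u] by (rule op_mult_one_left[OF fd2(1) fd2(2)[OF mem(4)]])
    finally have "?a \<Omega> \<star>\<^bsub>?I\<^esub> ?a C = g"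
      using mem by (simp only: a(4)[symmetric] ab)
    then have "W \<star>\<^bsub>?I\<^esub> ?a C = (?U \<star>\<^bsub>?I\<^esub> adj ?U) \<star>\<^bsub>?I\<^esub> Z"
      by (simp only: W_def g_def op_mult_assoc)
    also have "\<dots> = Z"
      unfolding unitary_inD(2)[OF U] by (rule op_mult_one_left[OF fd2(1) fd2(2)[OF mem(5)]])
    finally show ?thesis ..
  qed
  have "twisted_coprod G \<Omega> (\<gamma> x) = \<Omega> \<star>\<^bsub>?I\<^esub> (coprod G u \<star>\<^bsub>?I\<^esub> ?X \<star>\<^bsub>?I\<^esub> adj (coprod G u)) \<star>\<^bsub>?I\<^esub> adj \<Omega>"
    unfolding twisted_coprod_def \<gamma> I using uA al(1)[OF x] by (simp only: D(4,5) fd)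
  also have "\<dots> = Z \<star>\<^bsub>?I\<^esub> ?X \<star>\<^bsub>?I\<^esub> adj Z"
    by (simp only: Z_def adj_op_mult op_mult_assoc)
  also have "\<dots> = W \<star>\<^bsub>?I\<^esub> (?a C \<star>\<^bsub>?I\<^esub> ?X) \<star>\<^bsub>?I\<^esub> adj (?a C) \<star>\<^bsub>?I\<^esub> adj W"
    by (simp only: ZW adj_op_mult op_mult_assoc)
  also have "\<dots> = W \<star>\<^bsub>?I\<^esub> (?X \<star>\<^bsub>?I\<^esub> (?a C \<star>\<^bsub>?I\<^esub> adj (?a C))) \<star>\<^bsub>?I\<^esub> adj W"
    by (simp only: c_comm op_mult_assoc)
  also have "\<dots> = W \<star>\<^bsub>?I\<^esub> ?X \<star>\<^bsub>?I\<^esub> adj W"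
    by (simp only: unitary_inD(2)[OF cu] op_mult_one_right[OF fd2(1) fd2(2)[OF XA]])
  also have "\<dots> = ?U \<star>\<^bsub>?I\<^esub> (?a \<Omega> \<star>\<^bsub>?I\<^esub> ?a (coprod G x) \<star>\<^bsub>?I\<^esub> adj (?a \<Omega>)) \<star>\<^bsub>?I\<^esub> adj ?U"
    by (simp only: W_def aD[OF x] adj_op_mult op_mult_assoc)
  also have "\<dots> = ?U \<star>\<^bsub>?I\<^esub> ?a (twisted_coprod G \<Omega> x) \<star>\<^bsub>?I\<^esub> adj ?U"
    unfolding twisted_coprod_def I using unitary_inD(1)[OF \<Omega>u] D(1)[OF x] by (simp only: a(4,5) fd2)
  also have "\<dots> = tensor_map (cstar G) (cstar G) \<gamma> \<gamma> (twisted_coprod G \<Omega> x)"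
  proof -
    have "twisted_coprod G \<Omega> x \<in> ?A"
      unfolding twisted_coprod_def I using unitary_inD(1)[OF \<Omega>u] D(1)[OF x] by (simp only: fd2)
    from tensor_map_conj_group_map[OF this \<alpha>c(1) \<gamma>[unfolded aut_ext_eq_group_map]]
    show ?thesis
      by (simp add: adj_tensor)
  qed
  finally show ?thesis ..
qed

text \<open>
  The scalars \<open>\<epsilon>(u)\<close> and \<open>\<epsilon>(u\<^sup>*)\<close> are mutually inverse.
\<close>

lemma counit_conj_aut_ext:
  assumes \<alpha>: "\<alpha> \<in> hom G G" and u: "unitary_in (carrier G) (cstar G) u" and x: "x \<in> cstar G"
  shows "counit G (u \<star>\<^bsub>carrier G\<^esub> aut_ext G \<alpha> x \<star>\<^bsub>carrier G\<^esub> adj u) = counit G x"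
proof -
  note fd = fd_cstar_algebraD[OF fd_cstar_cstar]
  have al: "aut_ext G \<alpha> x \<in> cstar G"
    unfolding aut_ext_eq_group_map using x by (rule star_homD(1)[OF square.star_hom_group_map[OF \<alpha>]])
  have uA: "u \<in> cstar G" "adj u \<in> cstar G"
    using u by (auto simp: unitary_in_def fd)
  have "counit G u * counit G (adj u) = counit G (op_one (carrier G))"
    using uA u by (simp add: counit_mult[symmetric] unitary_in_def)
  also have "\<dots> = 1"
    by (simp add: counit_lreg lreg_one[symmetric])
  finally have "counit G u * counit G (aut_ext G \<alpha> x) * counit G (adj u) = counit G (aut_ext G \<alpha> x)"
    by (simp add: mult_ac)
  also have "\<dots> = counit G x"
    unfolding aut_ext_eq_group_map using x \<alpha> by (intro counit_group_map) (auto simp: hom_def)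
  finally show ?thesis
    using uA al by (simp add: counit_mult fd)
qed

text \<open>
  Both \<open>\<alpha>(\<kappa>\<^sub>\<Omega>(x))\<close> and \<open>\<kappa>(\<gamma>(x))\<close> equal \<open>u\<^sup>* \<kappa>(\<alpha>(x)) u\<close>: the former by \<open>\<alpha>(u) = u\<^sup>*\<close>, the latter by
  \<open>\<kappa>(u) = u\<close>. The remaining conjugation by \<open>u\<close> is the same on the two sides.
\<close>

lemma twisted_antipode_commute:
  assumes \<alpha>: "\<alpha> \<in> hom G G" and u: "unitary_in (carrier G) (cstar G) u"
    and \<alpha>u: "aut_ext G \<alpha> u = adj u" and \<kappa>u: "antipode G u = u"
    and \<gamma>: "\<gamma> = (\<lambda>x. u \<star>\<^bsub>carrier G\<^esub> aut_ext G \<alpha> x \<star>\<^bsub>carrier G\<^esub> adj u)"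
    and x: "x \<in> cstar G"
  shows "\<gamma> (twisted_antipode G u x) = twisted_antipode G u (\<gamma> x)"
proof -
  note fd = fd_cstar_algebraD[OF fd_cstar_cstar]
  have hom: "star_hom (carrier G) (cstar G) (carrier G) (cstar G) (aut_ext G \<alpha>)"
    unfolding aut_ext_eq_group_map by (rule square.star_hom_group_map[OF \<alpha>])
  note al = star_homD[OF hom]
  have uA: "u \<in> cstar G" "adj u \<in> cstar G"
    using u by (auto simp: unitary_in_def fd)
  note mem = uA x al(1)[OF x] antipode_in[OF x] antipode_in[OF al(1)[OF x]]
  let ?y = "antipode G (aut_ext G \<alpha> x)"
  have conj: "u \<star>\<^bsub>carrier G\<^esub> (adj u \<star>\<^bsub>carrier G\<^esub> ?y \<star>\<^bsub>carrier G\<^esub> u) \<star>\<^bsub>carrier G\<^esub> adj u = ?y"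
    using unitary_conj_cancel[OF fd_cstar_cstar unitary_in_adj[OF fd_cstar_cstar u] mem(6)] by simp
  have "aut_ext G \<alpha> (twisted_antipode G u x) = adj u \<star>\<^bsub>carrier G\<^esub> ?y \<star>\<^bsub>carrier G\<^esub> u"
    unfolding twisted_antipode_def using mem
    by (simp add: al(4,5) fd \<alpha>u aut_ext_antipode[OF \<alpha> x])
  moreover have "antipode G (\<gamma> x) = adj u \<star>\<^bsub>carrier G\<^esub> ?y \<star>\<^bsub>carrier G\<^esub> u"
    unfolding \<gamma> using mem by (simp add: antipode_mult antipode_adj fd \<kappa>u op_mult_assoc)
  ultimately show ?thesis
    by (simp add: \<gamma> twisted_antipode_def conj)
qed

end

theorem proposition3p6:
  fixes G :: "('a, 'b) monoid_scheme"
    and H :: "'a set"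
    and \<Omega> :: "('a \<times> 'a) oper"
    and u :: "'a oper"
    and \<alpha> :: "'a \<Rightarrow> 'a"
    and \<gamma> :: "'a oper \<Rightarrow> 'a oper"
  assumes "group G" and "finite (carrier G)"
    and "subgroup H G" and "comm_group (G\<lparr>carrier := H\<rparr>)"
    and "lifted_from G H \<Omega>"
    and "u = lifted_unitary G \<Omega>"
    and "two_cocycle G \<Omega> \<or> two_pseudo_cocycle G \<Omega>"
    and "co_involutive G \<Omega> u \<or> pseudo_co_involutive G \<Omega> u"
    and "kac_algebra (carrier G) (cstar G) (twisted_coprod G \<Omega>) (counit G) (twisted_antipode G u)"
    and "\<alpha> \<in> iso G G"
    and "\<gamma> = (\<lambda>x. u \<star>\<^bsub>carrier G\<^esub> aut_ext G \<alpha> x \<star>\<^bsub>carrier G\<^esub> adj u)"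
    and alpha_u: "aut_ext G \<alpha> u = adj u"
    and alpha_gauge: "aut_ext_inv2 G \<alpha> (gauge G \<Omega> u) \<star>\<^bsub>carrier2 G\<^esub> adj \<Omega> \<in> coprod_commutant G"
    and alpha_gauge_commute: "aut_ext_inv2 G \<alpha> (gauge G \<Omega> u) \<star>\<^bsub>carrier2 G\<^esub> adj \<Omega> =
           adj \<Omega> \<star>\<^bsub>carrier2 G\<^esub> aut_ext_inv2 G \<alpha> (gauge G \<Omega> u)"
    and counit_u: "counit G u = 1"
  shows "star_automorphism (carrier G) (cstar G) \<gamma> \<and>
    coalgebra_automorphism (cstar G) (twisted_coprod G \<Omega>) (counit G) \<gamma> \<and>
    (antipode G u = u \<longrightarrow>
       kac_automorphism (carrier G) (cstar G) (twisted_coprod G \<Omega>) (counit G)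
         (twisted_antipode G u) \<gamma>) \<and>
    (two_cocycle G \<Omega> \<and> counital G \<Omega> \<longrightarrow> antipode G u = u) \<and>
    (kac_automorphism (carrier G) (cstar G) (twisted_coprod G \<Omega>) (counit G)
         (twisted_antipode G u) \<gamma> \<longleftrightarrow>
       (\<forall>x\<in>cstar G. \<gamma> (twisted_antipode G u x) = twisted_antipode G u (\<gamma> x)))"
proof -
  interpret finite_group G
    using assms(1,2) by (simp add: finite_group_def finite_group_axioms_def)
  have u: "unitary_in (carrier G) (cstar G) u"
    using assms(8) by (auto simp: co_involutive_def pseudo_co_involutive_def)
  have \<Omega>: "unitary_in (carrier2 G) (cstar2 G) \<Omega>"
    using assms(7) by (auto simp: two_cocycle_def two_pseudo_cocycle_def)
  have \<alpha>: "\<alpha> \<in> hom G G" "bij_betw \<alpha> (carrier G) (carrier G)"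
    using assms(10) by (auto simp: iso_def)
  have aut: "star_automorphism (carrier G) (cstar G) \<gamma>"
    unfolding assms(11) aut_ext_eq_group_map
    by (rule star_automorphism_unitary_conj[OF fd_cstar_cstar star_automorphism_group_map[OF \<alpha>] u])
  \<comment> \<open>The assumed commutation puts \<open>\<Omega>\<^sup>*\<close> on the left, the side on which it cancels against \<open>\<Omega>\<close>.\<close>
  have coprod: "\<forall>x\<in>cstar G.
      tensor_map (cstar G) (cstar G) \<gamma> \<gamma> (twisted_coprod G \<Omega> x) = twisted_coprod G \<Omega> (\<gamma> x)"
    using twisted_coprod_intertwined[OF assms(10) u \<Omega> assms(11)] alpha_gauge alpha_gauge_commute
    by simp
  have counit: "\<forall>x\<in>cstar G. counit G (\<gamma> x) = counit G x"
    using counit_conj_aut_ext[OF \<alpha>(1) u] by (simp add: assms(11))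
  have "coalgebra_automorphism (cstar G) (twisted_coprod G \<Omega>) (counit G) \<gamma>"
    using aut coprod counit
    by (simp add: coalgebra_automorphism_def star_automorphism_def star_hom_def)
  moreover have kac: "kac_automorphism (carrier G) (cstar G) (twisted_coprod G \<Omega>) (counit G)
         (twisted_antipode G u) \<gamma> \<longleftrightarrow>
       (\<forall>x\<in>cstar G. \<gamma> (twisted_antipode G u x) = twisted_antipode G u (\<gamma> x))"
    using aut coprod counit by (simp add: kac_automorphism_def)
  moreover have "\<forall>x\<in>cstar G. \<gamma> (twisted_antipode G u x) = twisted_antipode G u (\<gamma> x)"
    if "antipode G u = u"
    using twisted_antipode_commute[OF \<alpha>(1) u alpha_u that assms(11)] by blast
  moreover have "antipode G u = u" if "two_cocycle G \<Omega> \<and> counital G \<Omega>"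
    using antipode_lifted_unitary[OF assms(3,4,5)] that by (simp add: assms(6))
  ultimately show ?thesis
    using aut by blast
qed

end
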